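(* Let $\mathfrak g_A$ be a Lie algebroid over a local Noetherian $k$-algebra $A$ and let $M$ be a $\mathfrak g_A$-module of finite type over $A$. (1) If $J$ is an ideal of definition relative to $A$, then $J$ is an ideal of definition relative to $M$. (2) If $J$ is an ideal of definition relative to $M$, then $\ell_{\mathfrak g_A}(M/J^{n+1}M)<\infty$ for any positive integer $n$.
   Context: $k$ is a field of characteristic $0$, rings are commutative, and $T_A$ is the $A$-module of $k$-linear derivations of $A$; for an ideal $J$, $T_A(J)=\{\delta\in T_A\mid\delta(J)\subset J\}$. A Lie algebroid over $A$ is an $A$-module $\mathfrak g_A$ of finite type with a $k$-Lie algebra structure and a homomorphism of Lie algebras and $A$-modules $\alpha:\mathfrak g_A\to T_A$ with $[\delta,r\eta]=\alpha(\delta)(r)\eta+r[\delta,\eta]$. A $\mathfrak g_A$-module is an $A$-module $M$ with an $A$-linear homomorphism of $k$-Lie algebras $\rho:\mathfrak g_A\to\mathrm{End}_k(M)$ with $\rho(\delta)(rm)=\alpha(\delta)(r)m+r\rho(\delta)(m)$; $A$ itself is a $\mathfrak g_A$-module via $\alpha$. $\ell_{\mathfrak g_A}$ denotes length as $\mathfrak g_A$-module. An ideal of definition relative to a $\mathfrak g_A$-module $M$ is an ideal $J\subset A$, $J\ne A$, such that $\alpha(\mathfrak g_A)\subset T_A(J)$ and $\ell_{\mathfrak g_A}(M/JM)<\infty$. *)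

theory Defs
  imports "HOL-Algebra.Algebra" "HOL-Library.Extended_Nat"
begin

text \<open>
  Linear maps, derivations and endomorphisms are HOL functions that matter only on the carrier:
  equations between such maps are stated pointwise on the carrier.
\<close>

definition char_zero :: "('k, 'c) ring_scheme \<Rightarrow> bool"
  where "char_zero K \<longleftrightarrow> (\<forall>n::nat. 0 < n \<longrightarrow> [n] \<cdot>\<^bsub>K\<^esub> \<one>\<^bsub>K\<^esub> \<noteq> \<zero>\<^bsub>K\<^esub>)"

definition local_ring :: "('a, 'c) ring_scheme \<Rightarrow> bool"
  where "local_ring A \<longleftrightarrow> cring A \<and> (\<exists>!m. maximalideal m A)"


subsection \<open>Modules\<close>

definition module_span :: "('a, 'c) ring_scheme \<Rightarrow> ('a, 'm, 'd) module_scheme \<Rightarrow> 'm set \<Rightarrow> 'm set"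
  where "module_span A M S = \<Inter> {N. submodule N A M \<and> S \<subseteq> N}"

definition finite_type :: "('a, 'c) ring_scheme \<Rightarrow> ('a, 'm, 'd) module_scheme \<Rightarrow> bool"
  where "finite_type A M \<longleftrightarrow> (\<exists>S. finite S \<and> S \<subseteq> carrier M \<and> module_span A M S = carrier M)"

definition ideal_smult :: "('a, 'c) ring_scheme \<Rightarrow> 'a set \<Rightarrow> ('a, 'm, 'd) module_scheme \<Rightarrow> 'm set"
  where "ideal_smult A J M = module_span A M {a \<odot>\<^bsub>M\<^esub> m | a m. a \<in> J \<and> m \<in> carrier M}"

abbreviation ideal_power :: "('a, 'c) ring_scheme \<Rightarrow> 'a set \<Rightarrow> nat \<Rightarrow> 'a set"
  where "ideal_power A J n \<equiv> J [^]\<^bsub>ideals_set A\<^esub> n"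

text \<open>
  An \<open>A\<close>-module seen as a \<open>k\<close>-module along the structure map \<open>c \<mapsto> c \<cdot> 1\<close> of the
  \<open>k\<close>-algebra \<open>A\<close>.  The record of modules extends that of rings, so the ring multiplication
  and unit have to be filled in; they play no role in a module.
\<close>

definition restrict_scalars ::
    "('k, 'a, 'c) module_scheme \<Rightarrow> ('a, 'm, 'd) module_scheme \<Rightarrow> ('k, 'm) module"
  where "restrict_scalars A M =
    \<lparr>carrier = carrier M, monoid.mult = monoid.mult M, one = one M, ring.zero = ring.zero M, add = add M,
     smult = (\<lambda>c x. (c \<odot>\<^bsub>A\<^esub> \<one>\<^bsub>A\<^esub>) \<odot>\<^bsub>M\<^esub> x)\<rparr>"

definition linear_endos :: "('k, 'c) ring_scheme \<Rightarrow> ('k, 'm, 'd) module_scheme \<Rightarrow> ('m \<Rightarrow> 'm) set"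
  where "linear_endos K V = {f \<in> carrier V \<rightarrow> carrier V.
    (\<forall>x\<in>carrier V. \<forall>y\<in>carrier V. f (x \<oplus>\<^bsub>V\<^esub> y) = f x \<oplus>\<^bsub>V\<^esub> f y) \<and>
    (\<forall>c\<in>carrier K. \<forall>x\<in>carrier V. f (c \<odot>\<^bsub>V\<^esub> x) = c \<odot>\<^bsub>V\<^esub> f x)}"

definition commutator :: "('m, 'd) ring_scheme \<Rightarrow> ('m \<Rightarrow> 'm) \<Rightarrow> ('m \<Rightarrow> 'm) \<Rightarrow> 'm \<Rightarrow> 'm"
  where "commutator V f g = (\<lambda>x. f (g x) \<ominus>\<^bsub>V\<^esub> g (f x))"


subsection \<open>Derivations\<close>

definition derivations :: "('k, 'c) ring_scheme \<Rightarrow> ('k, 'a, 'd) module_scheme \<Rightarrow> ('a \<Rightarrow> 'a) set"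
  where "derivations K A = {f \<in> linear_endos K A.
    \<forall>a\<in>carrier A. \<forall>b\<in>carrier A. f (a \<otimes>\<^bsub>A\<^esub> b) = f a \<otimes>\<^bsub>A\<^esub> b \<oplus>\<^bsub>A\<^esub> a \<otimes>\<^bsub>A\<^esub> f b}"

definition derivations_preserving ::
    "('k, 'c) ring_scheme \<Rightarrow> ('k, 'a, 'd) module_scheme \<Rightarrow> 'a set \<Rightarrow> ('a \<Rightarrow> 'a) set"
  where "derivations_preserving K A J = {f \<in> derivations K A. f ` J \<subseteq> J}"


subsection \<open>Lie algebroids and their modules\<close>

locale lie_algebra = module K L
  for K :: "('k, 'c) ring_scheme" and L :: "('k, 'l, 'd) module_scheme" +
  fixes br :: "'l \<Rightarrow> 'l \<Rightarrow> 'l"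
  assumes br_closed: "\<lbrakk>x \<in> carrier L; y \<in> carrier L\<rbrakk> \<Longrightarrow> br x y \<in> carrier L"
    and br_add_left: "\<lbrakk>x \<in> carrier L; y \<in> carrier L; z \<in> carrier L\<rbrakk>
      \<Longrightarrow> br (x \<oplus>\<^bsub>L\<^esub> y) z = br x z \<oplus>\<^bsub>L\<^esub> br y z"
    and br_add_right: "\<lbrakk>x \<in> carrier L; y \<in> carrier L; z \<in> carrier L\<rbrakk>
      \<Longrightarrow> br x (y \<oplus>\<^bsub>L\<^esub> z) = br x y \<oplus>\<^bsub>L\<^esub> br x z"
    and br_smult_left: "\<lbrakk>c \<in> carrier K; x \<in> carrier L; y \<in> carrier L\<rbrakk>
      \<Longrightarrow> br (c \<odot>\<^bsub>L\<^esub> x) y = c \<odot>\<^bsub>L\<^esub> br x y"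
    and br_smult_right: "\<lbrakk>c \<in> carrier K; x \<in> carrier L; y \<in> carrier L\<rbrakk>
      \<Longrightarrow> br x (c \<odot>\<^bsub>L\<^esub> y) = c \<odot>\<^bsub>L\<^esub> br x y"
    and br_alternating: "x \<in> carrier L \<Longrightarrow> br x x = \<zero>\<^bsub>L\<^esub>"
    and br_jacobi: "\<lbrakk>x \<in> carrier L; y \<in> carrier L; z \<in> carrier L\<rbrakk>
      \<Longrightarrow> br x (br y z) \<oplus>\<^bsub>L\<^esub> br y (br z x) \<oplus>\<^bsub>L\<^esub> br z (br x y) = \<zero>\<^bsub>L\<^esub>"

record ('a, 'g) algebroid = "('a, 'g) module" +
  bracket :: "'g \<Rightarrow> 'g \<Rightarrow> 'g"
  anchor :: "'g \<Rightarrow> 'a \<Rightarrow> 'a"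

locale lie_algebroid =
  fixes K :: "('k, 'c) ring_scheme" and A :: "('k, 'a, 'd) module_scheme"
    and G :: "('a, 'g, 'e) algebroid_scheme"
  assumes base_algebra: "algebra K A"
    and module: "module A G"
    and finite_type: "finite_type A G"
    and lie_algebra: "lie_algebra K (restrict_scalars A G) (bracket G)"
    and anchor_derivation: "x \<in> carrier G \<Longrightarrow> anchor G x \<in> derivations K A"
    and anchor_add: "\<lbrakk>x \<in> carrier G; y \<in> carrier G; r \<in> carrier A\<rbrakk>
      \<Longrightarrow> anchor G (x \<oplus>\<^bsub>G\<^esub> y) r = anchor G x r \<oplus>\<^bsub>A\<^esub> anchor G y r"
    and anchor_smult: "\<lbrakk>a \<in> carrier A; x \<in> carrier G; r \<in> carrier A\<rbrakk>
      \<Longrightarrow> anchor G (a \<odot>\<^bsub>G\<^esub> x) r = a \<otimes>\<^bsub>A\<^esub> anchor G x r"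
    and anchor_bracket: "\<lbrakk>x \<in> carrier G; y \<in> carrier G; r \<in> carrier A\<rbrakk>
      \<Longrightarrow> anchor G (bracket G x y) r = commutator A (anchor G x) (anchor G y) r"
    and leibniz: "\<lbrakk>x \<in> carrier G; y \<in> carrier G; r \<in> carrier A\<rbrakk>
      \<Longrightarrow> bracket G x (r \<odot>\<^bsub>G\<^esub> y) = (anchor G x r \<odot>\<^bsub>G\<^esub> y) \<oplus>\<^bsub>G\<^esub> (r \<odot>\<^bsub>G\<^esub> bracket G x y)"

record ('a, 'g, 'm) gmodule = "('a, 'm) module" +
  action :: "'g \<Rightarrow> 'm \<Rightarrow> 'm"

locale lie_algebroid_module = lie_algebroid K A G
  for K :: "('k, 'c) ring_scheme" and A :: "('k, 'a, 'd) module_scheme"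
    and G :: "('a, 'g, 'e) algebroid_scheme" +
  fixes M :: "('a, 'g, 'm, 'f) gmodule_scheme"
  assumes carrier_module: "module A M"
    and action_linear: "x \<in> carrier G \<Longrightarrow> action M x \<in> linear_endos K (restrict_scalars A M)"
    and action_add: "\<lbrakk>x \<in> carrier G; y \<in> carrier G; m \<in> carrier M\<rbrakk>
      \<Longrightarrow> action M (x \<oplus>\<^bsub>G\<^esub> y) m = action M x m \<oplus>\<^bsub>M\<^esub> action M y m"
    and action_smult: "\<lbrakk>a \<in> carrier A; x \<in> carrier G; m \<in> carrier M\<rbrakk>
      \<Longrightarrow> action M (a \<odot>\<^bsub>G\<^esub> x) m = a \<odot>\<^bsub>M\<^esub> action M x m"
    and action_bracket: "\<lbrakk>x \<in> carrier G; y \<in> carrier G; m \<in> carrier M\<rbrakk>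
      \<Longrightarrow> action M (bracket G x y) m = commutator M (action M x) (action M y) m"
    and action_leibniz: "\<lbrakk>x \<in> carrier G; r \<in> carrier A; m \<in> carrier M\<rbrakk>
      \<Longrightarrow> action M x (r \<odot>\<^bsub>M\<^esub> m) = (anchor G x r \<odot>\<^bsub>M\<^esub> m) \<oplus>\<^bsub>M\<^esub> (r \<odot>\<^bsub>M\<^esub> action M x m)"

definition base_gmodule ::
    "('k, 'a, 'd) module_scheme \<Rightarrow> ('a, 'g, 'e) algebroid_scheme \<Rightarrow> ('a, 'g, 'a) gmodule"
  where "base_gmodule A G =
    \<lparr>carrier = carrier A, monoid.mult = monoid.mult A, one = one A, ring.zero = ring.zero A, add = add A,
     smult = monoid.mult A, action = anchor G\<rparr>"

definition gsubmodule ::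
    "('a, 'c) ring_scheme \<Rightarrow> ('a, 'g, 'e) algebroid_scheme \<Rightarrow> ('a, 'g, 'm, 'f) gmodule_scheme
      \<Rightarrow> 'm set \<Rightarrow> bool"
  where "gsubmodule A G M N \<longleftrightarrow>
    submodule N A M \<and> (\<forall>x\<in>carrier G. \<forall>n\<in>N. action M x n \<in> N)"

text \<open>
  The operations on cosets are unions over representatives, as in \<^const>\<open>rcoset_mult\<close>; when
  \<open>N\<close> is a submodule stable under the action, each union is a single coset.
\<close>

definition quotient_gmodule ::
    "('a, 'g, 'm, 'f) gmodule_scheme \<Rightarrow> 'm set \<Rightarrow> ('a, 'g, 'm set) gmodule"
  where "quotient_gmodule M N =
    \<lparr>carrier = a_rcosets\<^bsub>M\<^esub> N, monoid.mult = undefined, one = undefined, ring.zero = N, add = set_add M,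
     smult = (\<lambda>a C. \<Union>m\<in>C. N +>\<^bsub>M\<^esub> (a \<odot>\<^bsub>M\<^esub> m)),
     action = (\<lambda>x C. \<Union>m\<in>C. N +>\<^bsub>M\<^esub> action M x m)\<rparr>"

text \<open>
  The length of a module over the Lie algebroid is the supremum of the lengths \<open>n\<close> of strict
  chains \<open>N\<^sub>0 \<subset> \<dots> \<subset> N\<^sub>n\<close> of submodules stable under the action.
\<close>

definition glength ::
    "('a, 'c) ring_scheme \<Rightarrow> ('a, 'g, 'e) algebroid_scheme \<Rightarrow> ('a, 'g, 'm, 'f) gmodule_scheme
      \<Rightarrow> enat"
  where "glength A G M = Sup {enat n | n.
    \<exists>N :: nat \<Rightarrow> 'm set. (\<forall>i\<le>n. gsubmodule A G M (N i)) \<and> (\<forall>i<n. N i \<subset> N (Suc i))}"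

definition ideal_of_definition ::
    "('k, 'c) ring_scheme \<Rightarrow> ('k, 'a, 'd) module_scheme \<Rightarrow> ('a, 'g, 'e) algebroid_scheme
      \<Rightarrow> ('a, 'g, 'm, 'f) gmodule_scheme \<Rightarrow> 'a set \<Rightarrow> bool"
  where "ideal_of_definition K A G M J \<longleftrightarrow>
    ideal J A \<and> J \<noteq> carrier A \<and>
    anchor G ` carrier G \<subseteq> derivations_preserving K A J \<and>
    glength A G (quotient_gmodule M (ideal_smult A J M)) < \<infinity>"

end

theory Submission
  imports Defs
begin

text \<open>
  Let \<open>m\<close> be the maximal ideal of \<open>A\<close>.  Call an ideal or a submodule stable if the Lie algebroid
  preserves it, and let \<open>P\<close> be the largest proper stable ideal of \<open>A\<close>; it is contained in \<open>m\<close> and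
  finitely generated.  Both claims follow from two facts about a module \<open>M\<close> of finite type over
  the Lie algebroid.

  (a) \<open>M/P\<^sup>t M\<close> has finite length for every \<open>t\<close> (lemma \<open>finite_height_powers\<close>).  It suffices to
  treat one layer \<open>L/P L\<close> with \<open>L = P\<^sup>i M\<close>.  For a stable \<open>U\<close> between \<open>P L\<close> and \<open>L\<close>, the
  coefficients of all relations among a minimal set of generators of \<open>L/U\<close> generate a stable ideal,
  which is proper by minimality since \<open>A\<close> is local, and so lies in \<open>P\<close>
  (lemma \<open>minimal_relation_stable\<close>).  Thus \<open>L/U\<close> is free over \<open>A/P\<close>, and its rank drops strictly
  when \<open>U\<close> grows, so the length of \<open>L/P L\<close> is at most the number of generators of \<open>L\<close>
  (lemma \<open>finite_height_layer\<close>).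

  (b) If \<open>M/N\<close> has finite length for a stable submodule \<open>N\<close>, then \<open>P\<^sup>t M \<subseteq> N\<close> for some \<open>t\<close>
  (lemma \<open>power_subset_of_finite_glength\<close>): the chain \<open>N + P\<^sup>i M\<close> becomes stationary, and the
  Nakayama lemma applies.

  If \<open>A/J\<close> has finite length, then \<open>P\<^sup>t \<subseteq> J\<close> by (b) applied to \<open>A\<close>, hence \<open>P\<^sup>t M \<subseteq> J M\<close>, and
  \<open>M/J M\<close> has finite length by (a).  If \<open>M/J M\<close> has finite length, then \<open>P\<^sup>t M \<subseteq> J M\<close> by (b), hence
  \<open>P\<^sup>t\<^sup>s M \<subseteq> J\<^sup>s M\<close> for every \<open>s\<close>, and \<open>M/J\<^sup>s M\<close> has finite length by (a).
\<close>

section \<open>Submodules and spans\<close>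

text \<open>
  The submodule \<open>I N\<close> spanned by the products of elements of \<open>I\<close> and \<open>N\<close>.  Below it is
  abbreviated \<open>imul I N\<close>, so that the iterate \<open>(imul I ^^ t) N\<close> is \<open>I\<^sup>t N\<close>, without any
  reference to the ideal \<open>I\<^sup>t\<close> itself.
\<close>

definition ideal_mult_submodule ::
    "('a, 'c) ring_scheme \<Rightarrow> ('a, 'm, 'd) module_scheme \<Rightarrow> 'a set \<Rightarrow> 'm set \<Rightarrow> 'm set"
  where "ideal_mult_submodule R M I N = module_span R M {a \<odot>\<^bsub>M\<^esub> n | a n. a \<in> I \<and> n \<in> N}"

context module
begin

abbreviation span :: "'c set \<Rightarrow> 'c set"
  where "span \<equiv> module_span R M"

abbreviation imul :: "'a set \<Rightarrow> 'c set \<Rightarrow> 'c set"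
  where "imul \<equiv> ideal_mult_submodule R M"

lemmas submodule_subset = submoduleE(1)
  and submodule_neg = submoduleE(3)
  and submodule_smult = submoduleE(4)
  and submodule_add = submoduleE(5)

lemma submodule_zero: "submodule N R M \<Longrightarrow> \<zero>\<^bsub>M\<^esub> \<in> N"
  using submoduleE(2,4)[of N] submodule_subset[of N]
  by (metis R.zero_closed all_not_in_conv smult_l_null subsetD)

lemma submodule_diff: "\<lbrakk>submodule N R M; x \<in> N; y \<in> N\<rbrakk> \<Longrightarrow> x \<ominus>\<^bsub>M\<^esub> y \<in> N"
  by (simp add: a_minus_def submodule_add submodule_neg)

text \<open>
  Closure under negation need not be checked, negation being multiplication by \<open>-1\<close>.
\<close>

lemma submodule_criterion:
  assumes "N \<subseteq> carrier M" "\<zero>\<^bsub>M\<^esub> \<in> N"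
    and "\<And>x y. \<lbrakk>x \<in> N; y \<in> N\<rbrakk> \<Longrightarrow> x \<oplus>\<^bsub>M\<^esub> y \<in> N"
    and "\<And>a x. \<lbrakk>a \<in> carrier R; x \<in> N\<rbrakk> \<Longrightarrow> a \<odot>\<^bsub>M\<^esub> x \<in> N"
  shows "submodule N R M"
proof (rule submoduleI)
  fix x assume "x \<in> N"
  moreover from this have "\<ominus>\<^bsub>M\<^esub> x = (\<ominus>\<^bsub>R\<^esub> \<one>\<^bsub>R\<^esub>) \<odot>\<^bsub>M\<^esub> x"
    using assms(1) by (simp add: smult_l_minus subset_iff)
  ultimately show "\<ominus>\<^bsub>M\<^esub> x \<in> N" using assms(4) by simp
qed (use assms in auto)

lemma submodule_Int:
  assumes "submodule N R M" "submodule L R M"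
  shows "submodule (N \<inter> L) R M"
  by (rule submodule_criterion)
    (use assms in \<open>auto simp: submodule_zero submodule_add submodule_smult dest: submodule_subset\<close>)

lemma submodule_Inter:
  assumes "\<F> \<noteq> {}" "\<And>N. N \<in> \<F> \<Longrightarrow> submodule N R M"
  shows "submodule (\<Inter>\<F>) R M"
  by (rule submodule_criterion)
    (use assms in \<open>auto simp: submodule_zero submodule_add submodule_smult dest: submodule_subset\<close>)

lemma span_submodule:
  assumes "S \<subseteq> carrier M"
  shows "submodule (span S) R M"
  unfolding module_span_def by (rule submodule_Inter) (use assms carrier_is_submodule in auto)

lemma span_superset: "S \<subseteq> span S"
  unfolding module_span_def by auto

lemma span_least: "\<lbrakk>submodule N R M; S \<subseteq> N\<rbrakk> \<Longrightarrow> span S \<subseteq> N"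
  unfolding module_span_def by auto

lemma span_mono: "S \<subseteq> T \<Longrightarrow> span S \<subseteq> span T"
  unfolding module_span_def by auto

lemma span_submodule_eq: "submodule N R M \<Longrightarrow> span N = N"
  by (simp add: span_least span_superset subset_antisym)

lemma span_Un_eq:
  assumes N: "submodule N R M" and L: "submodule L R M"
  shows "span (N \<union> L) = {x \<oplus>\<^bsub>M\<^esub> y | x y. x \<in> N \<and> y \<in> L}" (is "_ = ?S")
proof
  note c = submodule_subset[OF N] submodule_subset[OF L]
  have "submodule ?S R M"
  proof (rule submodule_criterion)
    show "?S \<subseteq> carrier M" using c by auto
    show "\<zero>\<^bsub>M\<^esub> \<in> ?S" using submodule_zero[OF N] submodule_zero[OF L] by force
  next
    fix u v assume "u \<in> ?S" "v \<in> ?S"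
    then obtain x y x' y' where *: "u = x \<oplus>\<^bsub>M\<^esub> y" "v = x' \<oplus>\<^bsub>M\<^esub> y'" "x \<in> N" "y \<in> L" "x' \<in> N" "y' \<in> L"
      by auto
    then have "u \<oplus>\<^bsub>M\<^esub> v = (x \<oplus>\<^bsub>M\<^esub> x') \<oplus>\<^bsub>M\<^esub> (y \<oplus>\<^bsub>M\<^esub> y')"
      using c by (simp add: subset_iff M.add.m_ac)
    with * show "u \<oplus>\<^bsub>M\<^esub> v \<in> ?S" using submodule_add[OF N] submodule_add[OF L] by blast
  next
    fix a u assume a: "a \<in> carrier R" and "u \<in> ?S"
    then obtain x y where *: "u = x \<oplus>\<^bsub>M\<^esub> y" "x \<in> N" "y \<in> L" by auto
    then have "a \<odot>\<^bsub>M\<^esub> u = a \<odot>\<^bsub>M\<^esub> x \<oplus>\<^bsub>M\<^esub> a \<odot>\<^bsub>M\<^esub> y"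
      using c a by (simp add: subset_iff smult_r_distr)
    with * show "a \<odot>\<^bsub>M\<^esub> u \<in> ?S" using submodule_smult[OF N a] submodule_smult[OF L a] by blast
  qed
  moreover have "N \<union> L \<subseteq> ?S"
  proof
    fix x assume "x \<in> N \<union> L"
    then show "x \<in> ?S"
    proof
      assume "x \<in> N"
      moreover from this have "x = x \<oplus>\<^bsub>M\<^esub> \<zero>\<^bsub>M\<^esub>" using c by auto
      ultimately show ?thesis using submodule_zero[OF L] by blast
    next
      assume "x \<in> L"
      moreover from this have "x = \<zero>\<^bsub>M\<^esub> \<oplus>\<^bsub>M\<^esub> x" using c by auto
      ultimately show ?thesis using submodule_zero[OF N] by blast
    qed
  qed
  ultimately show "span (N \<union> L) \<subseteq> ?S" by (rule span_least)
  have "submodule (span (N \<union> L)) R M" using c by (intro span_submodule) auto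
  then show "?S \<subseteq> span (N \<union> L)"
    using span_superset[of "N \<union> L"] by (auto intro!: submodule_add)
qed

text \<open>
  The only instance of modularity that additivity of heights needs: \<open>U \<subseteq> V\<close> with the same
  intersection with \<open>L\<close> and the same sum with \<open>L\<close> are equal.
\<close>

lemma modular_law:
  assumes U: "submodule U R M" and V: "submodule V R M" and L: "submodule L R M"
    and UV: "U \<subseteq> V" and int: "V \<inter> L \<subseteq> U" and sum: "span (V \<union> L) \<subseteq> span (U \<union> L)"
  shows "V \<subseteq> U"
proof
  fix y assume y: "y \<in> V"
  then have "y \<in> span (U \<union> L)" using sum span_superset[of "V \<union> L"] by auto
  then obtain x l where xl: "y = x \<oplus>\<^bsub>M\<^esub> l" "x \<in> U" "l \<in> L"
    using span_Un_eq[OF U L] by auto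
  then have "l = y \<ominus>\<^bsub>M\<^esub> x"
    using submodule_subset[OF U] submodule_subset[OF L] y
    by (simp add: subset_iff a_minus_def M.add.m_ac M.r_neg M.r_neg1)
  moreover have "y \<ominus>\<^bsub>M\<^esub> x \<in> V" using y xl(2) UV by (intro submodule_diff[OF V]) auto
  ultimately have "l \<in> V" by simp
  then show "y \<in> U" using xl int submodule_add[OF U] by auto
qed

section \<open>Products of ideals and submodules\<close>

lemma imul_submodule:
  assumes "I \<subseteq> carrier R" "N \<subseteq> carrier M"
  shows "submodule (imul I N) R M"
  unfolding ideal_mult_submodule_def by (rule span_submodule) (use assms in auto)

lemma imul_memI: "\<lbrakk>a \<in> I; n \<in> N\<rbrakk> \<Longrightarrow> a \<odot>\<^bsub>M\<^esub> n \<in> imul I N"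
  unfolding ideal_mult_submodule_def
  by (rule subsetD[OF span_superset]) blast

lemma imul_least:
  assumes "submodule L R M" "\<And>a n. \<lbrakk>a \<in> I; n \<in> N\<rbrakk> \<Longrightarrow> a \<odot>\<^bsub>M\<^esub> n \<in> L"
  shows "imul I N \<subseteq> L"
  unfolding ideal_mult_submodule_def by (rule span_least) (use assms in auto)

lemma imul_mono: "\<lbrakk>I \<subseteq> J; N \<subseteq> L\<rbrakk> \<Longrightarrow> imul I N \<subseteq> imul J L"
  unfolding ideal_mult_submodule_def by (rule span_mono) blast

lemma imul_subset: "\<lbrakk>I \<subseteq> carrier R; submodule N R M\<rbrakk> \<Longrightarrow> imul I N \<subseteq> N"
  by (rule imul_least) (auto simp: submodule_smult)

lemma submodule_colon:
  assumes a: "a \<in> carrier R" and L: "submodule L R M"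
  shows "submodule {x \<in> carrier M. a \<odot>\<^bsub>M\<^esub> x \<in> L} R M"
proof (rule submodule_criterion)
  fix b x assume b: "b \<in> carrier R" and x: "x \<in> {x \<in> carrier M. a \<odot>\<^bsub>M\<^esub> x \<in> L}"
  have "a \<odot>\<^bsub>M\<^esub> (b \<odot>\<^bsub>M\<^esub> x) = b \<odot>\<^bsub>M\<^esub> (a \<odot>\<^bsub>M\<^esub> x)"
    using a b x by (simp add: smult_assoc1[symmetric] R.m_comm)
  then show "b \<odot>\<^bsub>M\<^esub> x \<in> {x \<in> carrier M. a \<odot>\<^bsub>M\<^esub> x \<in> L}"
    using b x submodule_smult[OF L] by simp
qed (use a in \<open>auto simp: smult_r_distr submodule_add[OF L] submodule_zero[OF L]\<close>)

lemma imul_left_commute_subset: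
  assumes I: "I \<subseteq> carrier R" and J: "J \<subseteq> carrier R" and N: "N \<subseteq> carrier M"
  shows "imul I (imul J N) \<subseteq> imul J (imul I N)" (is "_ \<subseteq> ?W")
proof (rule imul_least)
  have IN: "imul I N \<subseteq> carrier M" by (rule submodule_subset[OF imul_submodule[OF I N]])
  show W: "submodule ?W R M" by (rule imul_submodule[OF J IN])
  fix a y assume a: "a \<in> I" and y: "y \<in> imul J N"
  have "imul J N \<subseteq> {x \<in> carrier M. a \<odot>\<^bsub>M\<^esub> x \<in> ?W}"
  proof (rule imul_least)
    show "submodule {x \<in> carrier M. a \<odot>\<^bsub>M\<^esub> x \<in> ?W} R M" using a I W by (intro submodule_colon) auto
    fix b n assume bn: "b \<in> J" "n \<in> N"
    then have "a \<odot>\<^bsub>M\<^esub> (b \<odot>\<^bsub>M\<^esub> n) = b \<odot>\<^bsub>M\<^esub> (a \<odot>\<^bsub>M\<^esub> n)"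
      using a I J N by (simp add: smult_assoc1[symmetric] R.m_comm subset_iff)
    then have "a \<odot>\<^bsub>M\<^esub> (b \<odot>\<^bsub>M\<^esub> n) \<in> ?W" using a bn imul_memI by metis
    then show "b \<odot>\<^bsub>M\<^esub> n \<in> {x \<in> carrier M. a \<odot>\<^bsub>M\<^esub> x \<in> ?W}" using bn J N by auto
  qed
  then show "a \<odot>\<^bsub>M\<^esub> y \<in> ?W" using y by auto
qed

lemma imul_left_commute:
  assumes I: "I \<subseteq> carrier R" and J: "J \<subseteq> carrier R" and N: "N \<subseteq> carrier M"
  shows "imul I (imul J N) = imul J (imul I N)"
  using imul_left_commute_subset[OF I J N] imul_left_commute_subset[OF J I N] by (rule subset_antisym)

lemma funpow_imul_submodule:
  assumes "I \<subseteq> carrier R" "submodule N R M"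
  shows "submodule ((imul I ^^ t) N) R M"
  by (induction t) (use assms imul_submodule submodule_subset in auto)

lemma funpow_imul_subset:
  assumes "I \<subseteq> carrier R" "submodule N R M"
  shows "(imul I ^^ Suc t) N \<subseteq> (imul I ^^ t) N"
  using imul_subset[OF assms(1) funpow_imul_submodule[OF assms]] by simp

lemma funpow_imul_mono:
  "N \<subseteq> L \<Longrightarrow> (imul I ^^ t) N \<subseteq> (imul I ^^ t) L"
  by (induction t) (auto intro: imul_mono[THEN subsetD])

lemma funpow_imul_commute:
  assumes "I \<subseteq> carrier R" "J \<subseteq> carrier R" "submodule N R M"
  shows "(imul I ^^ t) (imul J N) = imul J ((imul I ^^ t) N)"
  by (induction t)
    (use assms funpow_imul_submodule submodule_subset in \<open>auto simp: imul_left_commute\<close>)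

text \<open>
  \<open>I\<^sup>t N \<subseteq> J N\<close> implies \<open>I\<^sup>t\<^sup>s N \<subseteq> J\<^sup>s N\<close>.
\<close>

lemma funpow_imul_le:
  assumes "I \<subseteq> carrier R" "J \<subseteq> carrier R" and N: "submodule N R M"
    and le: "(imul I ^^ t) N \<subseteq> imul J N"
  shows "(imul I ^^ (t * s)) N \<subseteq> (imul J ^^ s) N"
proof (induction s)
  case (Suc s)
  have "(imul I ^^ (t * Suc s)) N = (imul I ^^ (t * s)) ((imul I ^^ t) N)"
    by (simp add: funpow_add[symmetric, THEN fun_cong, unfolded comp_def] add.commute)
  also have "\<dots> \<subseteq> (imul I ^^ (t * s)) (imul J N)" by (rule funpow_imul_mono[OF le])
  also have "\<dots> = imul J ((imul I ^^ (t * s)) N)" by (rule funpow_imul_commute[OF assms(1-3)])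
  also have "\<dots> \<subseteq> imul J ((imul J ^^ s) N)" using Suc by (intro imul_mono) auto
  finally show ?case by simp
qed simp

lemma imul_finitely_generated:
  assumes T: "finite T" "T \<subseteq> carrier R" and S: "finite S" "S \<subseteq> carrier M"
  shows "\<exists>U. finite U \<and> U \<subseteq> carrier M \<and> imul (genideal R T) (span S) = span U"
proof (intro exI conjI)
  let ?U = "(\<lambda>(t, s). t \<odot>\<^bsub>M\<^esub> s) ` (T \<times> S)"
  show "finite ?U" using T S by simp
  show U: "?U \<subseteq> carrier M" using T S by auto
  have W: "submodule (span ?U) R M" by (rule span_submodule[OF U])
  have Sp: "submodule (span S) R M" by (rule span_submodule[OF S(2)])
  have Tc: "genideal R T \<subseteq> carrier R"
    using R.genideal_ideal[OF T(2)] by (meson ideal.Icarr subsetI)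
  have 1: "span S \<subseteq> {x \<in> carrier M. t \<odot>\<^bsub>M\<^esub> x \<in> span ?U}" if t: "t \<in> T" for t
  proof (rule span_least)
    show "submodule {x \<in> carrier M. t \<odot>\<^bsub>M\<^esub> x \<in> span ?U} R M" using t T W by (intro submodule_colon) auto
    show "S \<subseteq> {x \<in> carrier M. t \<odot>\<^bsub>M\<^esub> x \<in> span ?U}"
      using t S span_superset[of ?U] by auto
  qed
  let ?Q = "{a \<in> carrier R. \<forall>x\<in>span S. a \<odot>\<^bsub>M\<^esub> x \<in> span ?U}"
  have "ideal ?Q R"
  proof (rule idealI)
    show "subgroup ?Q (add_monoid R)"
      using submodule_subset[OF Sp] W
      by (intro R.add.subgroupI)
        (auto simp: subset_iff smult_l_distr smult_l_minus submodule_zero submodule_add submodule_neg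
          a_inv_def[symmetric] intro!: exI[of _ "\<zero>\<^bsub>R\<^esub>"])
  next
    fix a b assume "a \<in> ?Q" "b \<in> carrier R"
    then show "b \<otimes>\<^bsub>R\<^esub> a \<in> ?Q" "a \<otimes>\<^bsub>R\<^esub> b \<in> ?Q"
      using submodule_subset[OF Sp] W
      by (auto simp: subset_iff smult_assoc1 submodule_smult R.m_comm[of a b])
  qed (rule R.ring_axioms)
  moreover have "T \<subseteq> ?Q" using 1 T by auto
  ultimately have "genideal R T \<subseteq> ?Q" by (rule R.genideal_minimal)
  then have "imul (genideal R T) (span S) \<subseteq> span ?U" by (intro imul_least[OF W]) auto
  moreover have "span ?U \<subseteq> imul (genideal R T) (span S)"
    using span_superset[of S] R.genideal_self[OF T(2)]
    by (intro span_least imul_submodule[OF Tc submodule_subset[OF Sp]]) (auto intro!: imul_memI)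
  ultimately show "imul (genideal R T) (span S) = span ?U" by (rule subset_antisym)
qed

section \<open>Linear combinations\<close>

text \<open>
  The linear combination of the elements of a finite set \<open>S\<close> with coefficients \<open>c\<close>, indexed by the
  elements of \<open>S\<close> themselves; it is zero by convention if \<open>S\<close> is infinite.
\<close>

definition lincomb :: "'c set \<Rightarrow> ('c \<Rightarrow> 'a) \<Rightarrow> 'c"
  where "lincomb S c = finsum M (\<lambda>s. c s \<odot>\<^bsub>M\<^esub> s) S"

lemma lincomb_empty [simp]: "lincomb {} c = \<zero>\<^bsub>M\<^esub>"
  by (simp add: lincomb_def)

lemma lincomb_insert:
  assumes "finite S" "s \<notin> S" "insert s S \<subseteq> carrier M" "c \<in> insert s S \<rightarrow> carrier R"
  shows "lincomb (insert s S) c = c s \<odot>\<^bsub>M\<^esub> s \<oplus>\<^bsub>M\<^esub> lincomb S c"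
  unfolding lincomb_def using assms by (intro M.finsum_insert) (auto simp: Pi_iff)

lemma lincomb_submodule:
  assumes "submodule N R M" "S \<subseteq> carrier M" "\<And>s. s \<in> S \<Longrightarrow> c s \<in> carrier R"
    "\<And>s. s \<in> S \<Longrightarrow> c s \<odot>\<^bsub>M\<^esub> s \<in> N"
  shows "lincomb S c \<in> N"
proof (cases "finite S")
  case True
  then show ?thesis using assms(2-4)
    by (induction S) (auto simp: lincomb_insert submodule_zero[OF assms(1)] Pi_iff intro!: submodule_add[OF assms(1)])
qed (simp add: lincomb_def submodule_zero[OF assms(1)])

lemma lincomb_closed:
  "\<lbrakk>S \<subseteq> carrier M; c \<in> S \<rightarrow> carrier R\<rbrakk> \<Longrightarrow> lincomb S c \<in> carrier M"
  by (rule lincomb_submodule[OF carrier_is_submodule]) auto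

lemma lincomb_add:
  assumes "S \<subseteq> carrier M" "c \<in> S \<rightarrow> carrier R" "d \<in> S \<rightarrow> carrier R"
  shows "lincomb S (\<lambda>s. c s \<oplus>\<^bsub>R\<^esub> d s) = lincomb S c \<oplus>\<^bsub>M\<^esub> lincomb S d"
proof -
  have "lincomb S (\<lambda>s. c s \<oplus>\<^bsub>R\<^esub> d s) = finsum M (\<lambda>s. c s \<odot>\<^bsub>M\<^esub> s \<oplus>\<^bsub>M\<^esub> d s \<odot>\<^bsub>M\<^esub> s) S"
    unfolding lincomb_def using assms by (intro M.finsum_cong') (auto simp: smult_l_distr Pi_iff)
  also have "\<dots> = lincomb S c \<oplus>\<^bsub>M\<^esub> lincomb S d"
    unfolding lincomb_def using assms by (intro M.finsum_addf) auto
  finally show ?thesis .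
qed

lemma lincomb_smult:
  assumes "finite S" "S \<subseteq> carrier M" "c \<in> S \<rightarrow> carrier R" "a \<in> carrier R"
  shows "lincomb S (\<lambda>s. a \<otimes>\<^bsub>R\<^esub> c s) = a \<odot>\<^bsub>M\<^esub> lincomb S c"
proof -
  have "lincomb S (\<lambda>s. a \<otimes>\<^bsub>R\<^esub> c s) = finsum M (\<lambda>s. a \<odot>\<^bsub>M\<^esub> (c s \<odot>\<^bsub>M\<^esub> s)) S"
    unfolding lincomb_def using assms by (intro M.finsum_cong') (auto simp: smult_assoc1 Pi_iff)
  also have "\<dots> = a \<odot>\<^bsub>M\<^esub> lincomb S c"
    unfolding lincomb_def using assms by (subst finsum_smult_ldistr) auto
  finally show ?thesis .
qed

lemma lincomb_zero: "S \<subseteq> carrier M \<Longrightarrow> lincomb S (\<lambda>s. \<zero>\<^bsub>R\<^esub>) = \<zero>\<^bsub>M\<^esub>"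
  using lincomb_submodule[of "{\<zero>\<^bsub>M\<^esub>}" S "\<lambda>s. \<zero>\<^bsub>R\<^esub>"] submodule_criterion[of "{\<zero>\<^bsub>M\<^esub>}"]
  by (auto simp: subset_iff)

lemma lincomb_delta:
  assumes "finite S" "S \<subseteq> carrier M" "s \<in> S"
  shows "lincomb S (\<lambda>t. if t = s then \<one>\<^bsub>R\<^esub> else \<zero>\<^bsub>R\<^esub>) = s"
proof -
  let ?d = "\<lambda>t. if t = s then \<one>\<^bsub>R\<^esub> else \<zero>\<^bsub>R\<^esub>"
  have "lincomb (insert s (S - {s})) ?d = ?d s \<odot>\<^bsub>M\<^esub> s \<oplus>\<^bsub>M\<^esub> lincomb (S - {s}) ?d"
    using assms by (intro lincomb_insert) auto
  moreover have "lincomb (S - {s}) ?d = lincomb (S - {s}) (\<lambda>t. \<zero>\<^bsub>R\<^esub>)"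
    unfolding lincomb_def using assms by (intro M.finsum_cong') auto
  ultimately show ?thesis using assms lincomb_zero[of "S - {s}"] by (auto simp: insert_absorb subset_iff)
qed

lemma lincomb_sum_submodule:
  assumes U: "submodule U R M" and S: "finite S" "S \<subseteq> carrier M" and I: "ideal I R"
  shows "submodule {x \<oplus>\<^bsub>M\<^esub> lincomb S c | x c. x \<in> U \<and> c \<in> S \<rightarrow> I} R M" (is "submodule ?T R M")
proof (rule submodule_criterion)
  note Uc = submodule_subset[OF U]
  have Ic: "I \<subseteq> carrier R" using I by (meson ideal.Icarr subsetI)
  have lc: "lincomb S c \<in> carrier M" if "c \<in> S \<rightarrow> I" for c
    using that Ic by (intro lincomb_closed S) auto
  show "?T \<subseteq> carrier M" using Uc lc by auto
  have "\<zero>\<^bsub>M\<^esub> = \<zero>\<^bsub>M\<^esub> \<oplus>\<^bsub>M\<^esub> lincomb S (\<lambda>s. \<zero>\<^bsub>R\<^esub>)" using lincomb_zero S by simp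
  moreover have "(\<lambda>s. \<zero>\<^bsub>R\<^esub>) \<in> S \<rightarrow> I" using I by (simp add: additive_subgroup.zero_closed ideal_def)
  ultimately show "\<zero>\<^bsub>M\<^esub> \<in> ?T" using submodule_zero[OF U] by blast
  fix u v assume "u \<in> ?T" "v \<in> ?T"
  then obtain x c y d where *: "u = x \<oplus>\<^bsub>M\<^esub> lincomb S c" "v = y \<oplus>\<^bsub>M\<^esub> lincomb S d"
    "x \<in> U" "y \<in> U" "c \<in> S \<rightarrow> I" "d \<in> S \<rightarrow> I" by auto
  have "lincomb S (\<lambda>s. c s \<oplus>\<^bsub>R\<^esub> d s) = lincomb S c \<oplus>\<^bsub>M\<^esub> lincomb S d"
    using * Ic S by (intro lincomb_add) auto
  then have "u \<oplus>\<^bsub>M\<^esub> v = (x \<oplus>\<^bsub>M\<^esub> y) \<oplus>\<^bsub>M\<^esub> lincomb S (\<lambda>s. c s \<oplus>\<^bsub>R\<^esub> d s)"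
    using * Uc lc by (simp add: subset_iff M.add.m_ac)
  moreover have "(\<lambda>s. c s \<oplus>\<^bsub>R\<^esub> d s) \<in> S \<rightarrow> I"
    using * I by (auto simp: Pi_iff ideal_def additive_subgroup.a_closed)
  ultimately show "u \<oplus>\<^bsub>M\<^esub> v \<in> ?T" using submodule_add[OF U] * by blast
next
  note Uc = submodule_subset[OF U]
  have Ic: "I \<subseteq> carrier R" using I by (meson ideal.Icarr subsetI)
  have lc: "lincomb S c \<in> carrier M" if "c \<in> S \<rightarrow> I" for c
    using that Ic by (intro lincomb_closed S) auto
  fix a u assume a: "a \<in> carrier R" and "u \<in> ?T"
  then obtain x c where *: "u = x \<oplus>\<^bsub>M\<^esub> lincomb S c" "x \<in> U" "c \<in> S \<rightarrow> I" by auto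
  have "lincomb S (\<lambda>s. a \<otimes>\<^bsub>R\<^esub> c s) = a \<odot>\<^bsub>M\<^esub> lincomb S c"
    using * Ic S a by (intro lincomb_smult) auto
  then have "a \<odot>\<^bsub>M\<^esub> u = a \<odot>\<^bsub>M\<^esub> x \<oplus>\<^bsub>M\<^esub> lincomb S (\<lambda>s. a \<otimes>\<^bsub>R\<^esub> c s)"
    using * Uc lc a by (simp add: subset_iff smult_r_distr)
  moreover have "(\<lambda>s. a \<otimes>\<^bsub>R\<^esub> c s) \<in> S \<rightarrow> I"
    using * I a by (auto simp: Pi_iff ideal.I_l_closed)
  ultimately show "a \<odot>\<^bsub>M\<^esub> u \<in> ?T" using submodule_smult[OF U a] * by blast
qed

lemma span_Un_lincomb:
  assumes U: "submodule U R M" and S: "finite S" "S \<subseteq> carrier M" and y: "y \<in> span (U \<union> S)"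
  obtains x c where "x \<in> U" "c \<in> S \<rightarrow> carrier R" "y = x \<oplus>\<^bsub>M\<^esub> lincomb S c"
proof -
  let ?T = "{x \<oplus>\<^bsub>M\<^esub> lincomb S c | x c. x \<in> U \<and> c \<in> S \<rightarrow> carrier R}"
  note Uc = submodule_subset[OF U]
  have "span (U \<union> S) \<subseteq> ?T"
  proof (rule span_least[OF lincomb_sum_submodule[OF U S R.oneideal]])
    show "U \<union> S \<subseteq> ?T"
    proof
      fix z assume "z \<in> U \<union> S"
      then show "z \<in> ?T"
      proof
        assume "z \<in> U"
        moreover from this have "z = z \<oplus>\<^bsub>M\<^esub> lincomb S (\<lambda>s. \<zero>\<^bsub>R\<^esub>)" using Uc lincomb_zero S by auto
        ultimately show ?thesis by blast
      next
        assume z: "z \<in> S"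
        then have "z = \<zero>\<^bsub>M\<^esub> \<oplus>\<^bsub>M\<^esub> lincomb S (\<lambda>t. if t = z then \<one>\<^bsub>R\<^esub> else \<zero>\<^bsub>R\<^esub>)"
          using lincomb_delta[OF S z] S by auto
        moreover have "(\<lambda>t. if t = z then \<one>\<^bsub>R\<^esub> else \<zero>\<^bsub>R\<^esub>) \<in> S \<rightarrow> carrier R" by auto
        ultimately show ?thesis using submodule_zero[OF U] by blast
      qed
    qed
  qed
  with y that show thesis by blast
qed

text \<open>
  If \<open>S\<close> generates \<open>L\<close> modulo \<open>U\<close>, then the elements of \<open>I L\<close> are, modulo \<open>U\<close>, linear combinations
  of \<open>S\<close> with coefficients in \<open>I\<close>.
\<close>

lemma imul_lincomb:
  assumes U: "submodule U R M" and S: "finite S" "S \<subseteq> carrier M" and I: "ideal I R"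
    and L: "L \<subseteq> span (U \<union> S)" and y: "y \<in> imul I L"
  obtains x c where "x \<in> U" "c \<in> S \<rightarrow> I" "y = x \<oplus>\<^bsub>M\<^esub> lincomb S c"
proof -
  let ?T = "{x \<oplus>\<^bsub>M\<^esub> lincomb S c | x c. x \<in> U \<and> c \<in> S \<rightarrow> I}"
  note Uc = submodule_subset[OF U]
  have Ic: "I \<subseteq> carrier R" using I by (meson ideal.Icarr subsetI)
  have "imul I L \<subseteq> ?T"
  proof (rule imul_least[OF lincomb_sum_submodule[OF U S I]])
    fix a l assume a: "a \<in> I" and "l \<in> L"
    then have "l \<in> span (U \<union> S)" using L by auto
    then obtain x c where *: "x \<in> U" "c \<in> S \<rightarrow> carrier R" "l = x \<oplus>\<^bsub>M\<^esub> lincomb S c"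
      by (rule span_Un_lincomb[OF U S])
    have "lincomb S (\<lambda>s. a \<otimes>\<^bsub>R\<^esub> c s) = a \<odot>\<^bsub>M\<^esub> lincomb S c"
      using * Ic S a by (intro lincomb_smult) auto
    then have "a \<odot>\<^bsub>M\<^esub> l = a \<odot>\<^bsub>M\<^esub> x \<oplus>\<^bsub>M\<^esub> lincomb S (\<lambda>s. a \<otimes>\<^bsub>R\<^esub> c s)"
      using * Uc lincomb_closed[OF S(2)] a Ic by (simp add: subset_iff smult_r_distr)
    moreover have "(\<lambda>s. a \<otimes>\<^bsub>R\<^esub> c s) \<in> S \<rightarrow> I"
      using * I a by (auto simp: Pi_iff ideal.I_r_closed)
    ultimately show "a \<odot>\<^bsub>M\<^esub> l \<in> ?T" using submodule_smult[OF U] * a Ic by blast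
  qed
  with y that show thesis by blast
qed

section \<open>Minimal generating sets and the Nakayama lemma\<close>

text \<open>
  \<open>S\<close> is a finite subset of \<open>L\<close> whose classes generate \<open>L\<close> modulo \<open>U\<close>.  The submodule \<open>U\<close> is not
  required to lie in \<open>L\<close>.
\<close>

definition generates_mod :: "'c set \<Rightarrow> 'c set \<Rightarrow> 'c set \<Rightarrow> bool"
  where "generates_mod U L S \<longleftrightarrow> finite S \<and> S \<subseteq> L \<and> L \<subseteq> span (U \<union> S)"

text \<open>
  The least number of generators of \<open>L\<close> modulo \<open>U\<close>; meaningful only if a finite set of generators
  exists.
\<close>

definition num_gens :: "'c set \<Rightarrow> 'c set \<Rightarrow> nat"
  where "num_gens U L = (LEAST n. \<exists>S. generates_mod U L S \<and> card S = n)"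

lemma num_gens_le: "generates_mod U L S \<Longrightarrow> num_gens U L \<le> card S"
  unfolding num_gens_def by (rule Least_le) blast

lemma num_gens_attained:
  assumes "generates_mod U L S"
  obtains S' where "generates_mod U L S'" "card S' = num_gens U L"
proof -
  have "\<exists>S'. generates_mod U L S' \<and> card S' = num_gens U L"
    unfolding num_gens_def by (rule LeastI[of _ "card S"]) (use assms in blast)
  then show thesis using that by blast
qed

lemma generates_mod_mono:
  "\<lbrakk>generates_mod U L S; U \<subseteq> V\<rbrakk> \<Longrightarrow> generates_mod V L S"
  unfolding generates_mod_def using span_mono[of "U \<union> S" "V \<union> S"] by blast

lemma minimal_relation_nonunit:
  assumes U: "submodule U R M" and L: "L \<subseteq> carrier M"
    and gen: "generates_mod U L S" and min: "card S = num_gens U L"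
    and c: "c \<in> S \<rightarrow> carrier R" and rel: "lincomb S c \<in> U" and s: "s \<in> S"
  shows "c s \<notin> Units R"
proof
  assume u: "c s \<in> Units R"
  define v where "v = inv\<^bsub>R\<^esub> (c s)"
  have v: "v \<in> carrier R" "v \<otimes>\<^bsub>R\<^esub> c s = \<one>\<^bsub>R\<^esub>" using u by (auto simp: v_def)
  have S: "finite S" "S \<subseteq> carrier M" "L \<subseteq> span (U \<union> S)" "S \<subseteq> L" using gen L by (auto simp: generates_mod_def)
  let ?S = "S - {s}" and ?W = "span (U \<union> (S - {s}))"
  have W: "submodule ?W R M" using submodule_subset[OF U] S by (intro span_submodule) auto
  have rest: "lincomb ?S c \<in> ?W"
    using S c span_superset[of "U \<union> ?S"] by (intro lincomb_submodule[OF W] submodule_smult[OF W]) auto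
  have sc: "s \<in> carrier M" "c s \<in> carrier R" using s S c by auto
  have "lincomb (insert s ?S) c = c s \<odot>\<^bsub>M\<^esub> s \<oplus>\<^bsub>M\<^esub> lincomb ?S c"
    using S c s by (intro lincomb_insert) auto
  then have eq: "lincomb S c = c s \<odot>\<^bsub>M\<^esub> s \<oplus>\<^bsub>M\<^esub> lincomb ?S c" using s by (simp add: insert_absorb)
  have "c s \<odot>\<^bsub>M\<^esub> s = lincomb S c \<ominus>\<^bsub>M\<^esub> lincomb ?S c"
    unfolding eq using sc submodule_subset[OF W] rest
    by (simp add: subset_iff a_minus_def M.add.m_assoc M.r_neg)
  moreover have "lincomb S c \<in> ?W" using rel span_superset[of "U \<union> ?S"] by auto
  ultimately have "c s \<odot>\<^bsub>M\<^esub> s \<in> ?W" using submodule_diff[OF W] rest by simp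
  then have "v \<odot>\<^bsub>M\<^esub> (c s \<odot>\<^bsub>M\<^esub> s) \<in> ?W" by (rule submodule_smult[OF W v(1)])
  then have "s \<in> ?W" using v sc by (simp add: smult_assoc1[symmetric])
  then have "U \<union> S \<subseteq> ?W" using span_superset[of "U \<union> ?S"] by auto
  then have "L \<subseteq> ?W" using span_least[OF W] S by blast
  then have "generates_mod U L ?S" using S by (auto simp: generates_mod_def)
  then have "num_gens U L \<le> card ?S" by (rule num_gens_le)
  then show False using min card_Diff1_less[OF S(1) s] by simp
qed

text \<open>
  The Nakayama lemma for the finitely generated module \<open>span S\<close> relative to a submodule \<open>U\<close> of the
  ambient module: if \<open>L \<subseteq> U + I L\<close> with \<open>I\<close> inside the maximal ideal, then \<open>L \<subseteq> U\<close>.  A minimal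
  generator \<open>s\<close> would be \<open>u + \<Sum> c t \<cdot> t\<close> with coefficients in \<open>I\<close>, a relation in which \<open>s\<close> has the
  unit coefficient \<open>1 - c s\<close>.
\<close>

lemma nakayama:
  assumes m: "ideal m R" "m \<noteq> carrier R" and units: "carrier R - m \<subseteq> Units R"
    and I: "ideal I R" "I \<subseteq> m"
    and U: "submodule U R M" and S: "finite S" "S \<subseteq> carrier M"
    and L: "span S \<subseteq> span (U \<union> imul I (span S))"
  shows "span S \<subseteq> U"
proof -
  let ?L = "span S"
  have Lc: "submodule ?L R M" by (rule span_submodule[OF S(2)])
  have Ic: "I \<subseteq> carrier R" using I by (meson ideal.Icarr subsetI)
  have mc: "m \<subseteq> carrier R" using m by (meson ideal.Icarr subsetI)
  have IL: "submodule (imul I ?L) R M" by (rule imul_submodule[OF Ic submodule_subset[OF Lc]])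
  have "generates_mod U ?L S"
    using S span_superset[of S] span_mono[of S "U \<union> S"] by (auto simp: generates_mod_def)
  then obtain T where T: "generates_mod U ?L T" "card T = num_gens U ?L" by (rule num_gens_attained)
  have Tc: "finite T" "T \<subseteq> carrier M" "?L \<subseteq> span (U \<union> T)"
    using T(1) submodule_subset[OF Lc] by (auto simp: generates_mod_def)
  have "T = {}"
  proof (rule ccontr)
    assume "T \<noteq> {}"
    then obtain s where s: "s \<in> T" by auto
    then have "s \<in> span (U \<union> imul I ?L)" using T L by (auto simp: generates_mod_def)
    then obtain x y where xy: "s = x \<oplus>\<^bsub>M\<^esub> y" "x \<in> U" "y \<in> imul I ?L"
      using span_Un_eq[OF U IL] by auto
    obtain x' c where c: "x' \<in> U" "c \<in> T \<rightarrow> I" "y = x' \<oplus>\<^bsub>M\<^esub> lincomb T c"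
      by (rule imul_lincomb[OF U Tc(1,2) I(1) Tc(3) xy(3)])
    have cc: "c \<in> T \<rightarrow> carrier R" using c Ic by auto
    let ?d = "\<lambda>t. (if t = s then \<one>\<^bsub>R\<^esub> else \<zero>\<^bsub>R\<^esub>)"
    \<comment> \<open>the coefficients of \<open>s - \<Sum> c t \<cdot> t = x + x'\<close>, an element of \<open>U\<close>\<close>
    define e where "e = (\<lambda>t. ?d t \<oplus>\<^bsub>R\<^esub> (\<ominus>\<^bsub>R\<^esub> \<one>\<^bsub>R\<^esub>) \<otimes>\<^bsub>R\<^esub> c t)"
    have lcc: "lincomb T c \<in> carrier M" by (rule lincomb_closed[OF Tc(2) cc])
    have "lincomb T e = lincomb T ?d \<oplus>\<^bsub>M\<^esub> lincomb T (\<lambda>t. (\<ominus>\<^bsub>R\<^esub> \<one>\<^bsub>R\<^esub>) \<otimes>\<^bsub>R\<^esub> c t)"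
      unfolding e_def using Tc cc by (intro lincomb_add) auto
    also have "\<dots> = s \<oplus>\<^bsub>M\<^esub> (\<ominus>\<^bsub>R\<^esub> \<one>\<^bsub>R\<^esub>) \<odot>\<^bsub>M\<^esub> lincomb T c"
      using lincomb_delta[OF Tc(1,2) s] lincomb_smult[OF Tc(1,2) cc] by simp
    also have "\<dots> = s \<oplus>\<^bsub>M\<^esub> \<ominus>\<^bsub>M\<^esub> lincomb T c" using lcc by (simp add: smult_l_minus)
    also have "\<dots> = x \<oplus>\<^bsub>M\<^esub> x'"
      using xy c lcc submodule_subset[OF U] by (simp add: subset_iff M.add.m_assoc M.r_neg)
    finally have "lincomb T e \<in> U" using submodule_add[OF U] xy c by simp
    moreover have "e \<in> T \<rightarrow> carrier R" using cc by (auto simp: e_def Pi_iff)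
    ultimately have nu: "e s \<notin> Units R"
      using minimal_relation_nonunit[OF U submodule_subset[OF Lc] T] s by blast
    have cs: "c s \<in> m" "c s \<in> carrier R" using c s I mc by auto
    have es: "e s = \<one>\<^bsub>R\<^esub> \<ominus>\<^bsub>R\<^esub> c s" using cs by (simp add: e_def a_minus_def R.l_minus)
    have "e s \<in> carrier R" using es cs by simp
    then have "e s \<in> m" using nu units by auto
    then have "e s \<oplus>\<^bsub>R\<^esub> c s \<in> m" using cs m by (simp add: ideal_def additive_subgroup.a_closed)
    moreover have "e s \<oplus>\<^bsub>R\<^esub> c s = \<one>\<^bsub>R\<^esub>" unfolding es using cs by (simp add: a_minus_def R.add.m_assoc R.l_neg)
    ultimately show False using m ideal.one_imp_carrier by metis
  qed
  then show ?thesis using Tc(3) span_submodule_eq[OF U] by simp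
qed

end

section \<open>Stable ideals\<close>

lemma (in lie_algebroid) base_cring: "cring A"
  using base_algebra by (simp add: algebra_def)

text \<open>
  Ideals of \<open>A\<close> preserved by the derivations in the image of the anchor.
\<close>

definition stable_ideal ::
    "('k, 'a, 'd) module_scheme \<Rightarrow> ('a, 'g, 'e) algebroid_scheme \<Rightarrow> 'a set \<Rightarrow> bool"
  where "stable_ideal A G I \<longleftrightarrow> ideal I A \<and> (\<forall>x\<in>carrier G. \<forall>r\<in>I. anchor G x r \<in> I)"

text \<open>
  The ideal generated by all proper stable ideals.  It is stable; over a local ring it lies in the
  maximal ideal, hence is then the largest proper stable ideal.
\<close>

definition largest_stable_ideal ::
    "('k, 'a, 'd) module_scheme \<Rightarrow> ('a, 'g, 'e) algebroid_scheme \<Rightarrow> 'a set"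
  where "largest_stable_ideal A G = genideal A (\<Union>{I. stable_ideal A G I \<and> I \<noteq> carrier A})"

context lie_algebroid
begin

lemma anchor_closed: "\<lbrakk>x \<in> carrier G; r \<in> carrier A\<rbrakk> \<Longrightarrow> anchor G x r \<in> carrier A"
  using anchor_derivation by (auto simp: derivations_def linear_endos_def Pi_iff)

lemma anchor_sum:
  "\<lbrakk>x \<in> carrier G; r \<in> carrier A; s \<in> carrier A\<rbrakk>
    \<Longrightarrow> anchor G x (r \<oplus>\<^bsub>A\<^esub> s) = anchor G x r \<oplus>\<^bsub>A\<^esub> anchor G x s"
  using anchor_derivation by (auto simp: derivations_def linear_endos_def)

lemma anchor_mult:
  "\<lbrakk>x \<in> carrier G; r \<in> carrier A; s \<in> carrier A\<rbrakk>
    \<Longrightarrow> anchor G x (r \<otimes>\<^bsub>A\<^esub> s) = anchor G x r \<otimes>\<^bsub>A\<^esub> s \<oplus>\<^bsub>A\<^esub> r \<otimes>\<^bsub>A\<^esub> anchor G x s"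
  using anchor_derivation by (auto simp: derivations_def)

lemma anchor_zero: "x \<in> carrier G \<Longrightarrow> anchor G x \<zero>\<^bsub>A\<^esub> = \<zero>\<^bsub>A\<^esub>"
proof -
  interpret A: cring A by (rule base_cring)
  assume x: "x \<in> carrier G"
  have "anchor G x \<zero>\<^bsub>A\<^esub> = anchor G x \<zero>\<^bsub>A\<^esub> \<oplus>\<^bsub>A\<^esub> anchor G x \<zero>\<^bsub>A\<^esub>"
    using anchor_sum[OF x, of "\<zero>\<^bsub>A\<^esub>" "\<zero>\<^bsub>A\<^esub>"] by simp
  then show ?thesis using anchor_closed[OF x, of "\<zero>\<^bsub>A\<^esub>"] by simp
qed

lemma anchor_neg:
  assumes x: "x \<in> carrier G" and r: "r \<in> carrier A"
  shows "anchor G x (\<ominus>\<^bsub>A\<^esub> r) = \<ominus>\<^bsub>A\<^esub> anchor G x r"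
proof -
  interpret A: cring A by (rule base_cring)
  have "anchor G x (\<ominus>\<^bsub>A\<^esub> r) \<oplus>\<^bsub>A\<^esub> anchor G x r = \<zero>\<^bsub>A\<^esub>"
    using anchor_sum[OF x, of "\<ominus>\<^bsub>A\<^esub> r" r] anchor_zero[OF x] r by (simp add: A.l_neg)
  then show ?thesis using A.minus_equality anchor_closed[OF x] r by simp
qed

lemma stable_genideal:
  assumes S: "S \<subseteq> carrier A"
    and stable: "\<And>x s. \<lbrakk>x \<in> carrier G; s \<in> S\<rbrakk> \<Longrightarrow> anchor G x s \<in> genideal A S"
  shows "stable_ideal A G (genideal A S)"
proof -
  interpret A: cring A by (rule base_cring)
  let ?I = "genideal A S" and ?Q = "{r \<in> genideal A S. \<forall>x\<in>carrier G. anchor G x r \<in> genideal A S}"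
  interpret I: ideal ?I A by (rule A.genideal_ideal[OF S])
  have "ideal ?Q A"
  proof (rule idealI)
    show "subgroup ?Q (add_monoid A)"
      by (rule A.add.subgroupI)
        (auto simp: anchor_sum anchor_zero anchor_neg a_inv_def[symmetric] intro!: exI[of _ "\<zero>\<^bsub>A\<^esub>"])
  next
    fix r a assume "r \<in> ?Q" "a \<in> carrier A"
    then show "a \<otimes>\<^bsub>A\<^esub> r \<in> ?Q" "r \<otimes>\<^bsub>A\<^esub> a \<in> ?Q"
      by (auto simp: anchor_mult anchor_closed I.I_l_closed I.I_r_closed)
  qed (rule A.ring_axioms)
  moreover have "S \<subseteq> ?Q" using stable A.genideal_self[OF S] by auto
  ultimately have "?I \<subseteq> ?Q" by (rule A.genideal_minimal)
  then show ?thesis using I.ideal_axioms by (auto simp: stable_ideal_def)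
qed

abbreviation largest_stable :: "'a set"
  where "largest_stable \<equiv> largest_stable_ideal A G"

lemma largest_stable_upper: 
  assumes "stable_ideal A G I" "I \<noteq> carrier A"
  shows "I \<subseteq> largest_stable"
proof -
  interpret A: cring A by (rule base_cring)
  have "\<Union>{I. stable_ideal A G I \<and> I \<noteq> carrier A} \<subseteq> carrier A" by (auto simp: stable_ideal_def ideal.Icarr)
  from A.genideal_self[OF this] show ?thesis unfolding largest_stable_ideal_def using assms by auto
qed

lemma largest_stable_stable: "stable_ideal A G largest_stable"
  unfolding largest_stable_ideal_def
proof (rule stable_genideal)
  interpret A: cring A by (rule base_cring)
  show *: "\<Union>{I. stable_ideal A G I \<and> I \<noteq> carrier A} \<subseteq> carrier A" by (auto simp: stable_ideal_def ideal.Icarr)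
  show "anchor G x s \<in> genideal A (\<Union>{I. stable_ideal A G I \<and> I \<noteq> carrier A})"
    if "x \<in> carrier G" "s \<in> \<Union>{I. stable_ideal A G I \<and> I \<noteq> carrier A}" for x s
    using that A.genideal_self[OF *] by (auto simp: stable_ideal_def)
qed

end

section \<open>Noetherian local rings\<close>

lemma noetherian_maximal_exists:
  assumes "noetherian_ring A" "cring A" and I: "ideal I A" "I \<noteq> carrier A"
  shows "\<exists>m. maximalideal m A \<and> I \<subseteq> m"
proof -
  interpret A: cring A by fact
  let ?F = "{J. ideal J A \<and> J \<noteq> carrier A \<and> I \<subseteq> J}"
  have "\<exists>m\<in>?F. \<forall>J\<in>?F. m \<subseteq> J \<longrightarrow> J = m"
  proof (rule subset_Zorn_nonempty)
    show "?F \<noteq> {}" using I by auto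
    fix C assume C: "C \<noteq> {}" "subset.chain ?F C"
    then have "subset.chain {J. ideal J A} C" by (auto simp: subset_chain_def)
    then have "\<Union>C \<in> C" using noetherian_ring.ideal_chain_is_trivial[OF assms(1) C(1)] by simp
    then show "\<Union>C \<in> ?F" using C(2) by (auto simp: subset_chain_def)
  qed
  then obtain m where m: "m \<in> ?F" and max: "\<And>J. \<lbrakk>J \<in> ?F; m \<subseteq> J\<rbrakk> \<Longrightarrow> J = m" by auto
  have "maximalideal m A"
  proof (rule maximalidealI)
    show "ideal m A" "carrier A \<noteq> m" using m by auto
    fix J assume "ideal J A" "m \<subseteq> J" "J \<subseteq> carrier A"
    then show "J = m \<or> J = carrier A" using m max[of J] by auto
  qed
  with m show ?thesis by auto
qed

lemma noetherian_local_ringE: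
  assumes "noetherian_ring A" "local_ring A"
  obtains m where "ideal m A" "m \<noteq> carrier A" "carrier A - m \<subseteq> Units A"
    "\<And>I. \<lbrakk>ideal I A; I \<noteq> carrier A\<rbrakk> \<Longrightarrow> I \<subseteq> m"
proof -
  have cr: "cring A" using assms by (simp add: local_ring_def)
  interpret A: cring A by fact
  obtain m where m: "maximalideal m A" and uniq: "\<And>n. maximalideal n A \<Longrightarrow> n = m"
    using assms(2) by (auto simp: local_ring_def)
  have le: "I \<subseteq> m" if "ideal I A" "I \<noteq> carrier A" for I
    using noetherian_maximal_exists[OF assms(1) cr that] uniq by auto
  have "carrier A - m \<subseteq> Units A"
  proof
    fix a assume a: "a \<in> carrier A - m"
    have "a \<in> genideal A {a}" using A.genideal_self'[of a] a by simp
    then have "genideal A {a} = carrier A" using le[of "genideal A {a}"] A.genideal_ideal[of "{a}"] a by auto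
    then have "\<one>\<^bsub>A\<^esub> \<in> cgenideal A a" using A.cgenideal_eq_genideal[of a] a by simp
    then obtain b where b: "b \<in> carrier A" "\<one>\<^bsub>A\<^esub> = b \<otimes>\<^bsub>A\<^esub> a" by (auto simp: cgenideal_def)
    then show "a \<in> Units A" using a A.m_comm[of a b] by (auto simp: Units_def)
  qed
  moreover have "ideal m A" "m \<noteq> carrier A"
    using m maximalideal.I_notcarr[OF m] by (auto simp: maximalideal_def)
  ultimately show thesis using that le by blast
qed

section \<open>Stable submodules\<close>

context lie_algebroid_module
begin

sublocale M: Module.module A M by (rule carrier_module)

abbreviation stable :: "'m set \<Rightarrow> bool" where "stable \<equiv> gsubmodule A G M"

lemma action_closed: "\<lbrakk>x \<in> carrier G; m \<in> carrier M\<rbrakk> \<Longrightarrow> action M x m \<in> carrier M"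
  using action_linear by (auto simp: linear_endos_def restrict_scalars_def Pi_iff)

lemma action_sum:
  "\<lbrakk>x \<in> carrier G; m \<in> carrier M; n \<in> carrier M\<rbrakk>
    \<Longrightarrow> action M x (m \<oplus>\<^bsub>M\<^esub> n) = action M x m \<oplus>\<^bsub>M\<^esub> action M x n"
  using action_linear by (auto simp: linear_endos_def restrict_scalars_def)

lemma action_zero: "x \<in> carrier G \<Longrightarrow> action M x \<zero>\<^bsub>M\<^esub> = \<zero>\<^bsub>M\<^esub>"
  using action_sum[of x "\<zero>\<^bsub>M\<^esub>" "\<zero>\<^bsub>M\<^esub>"] action_closed[of x "\<zero>\<^bsub>M\<^esub>"] by simp

lemma stable_submodule: "stable N \<Longrightarrow> submodule N A M"
  by (simp add: gsubmodule_def)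

lemma stable_action: "\<lbrakk>stable N; x \<in> carrier G; n \<in> N\<rbrakk> \<Longrightarrow> action M x n \<in> N"
  by (simp add: gsubmodule_def)

lemma stable_carrier: "stable (carrier M)"
  by (simp add: gsubmodule_def M.carrier_is_submodule action_closed)

lemma stable_span:
  assumes S: "S \<subseteq> carrier M"
    and act: "\<And>x s. \<lbrakk>x \<in> carrier G; s \<in> S\<rbrakk> \<Longrightarrow> action M x s \<in> M.span S"
  shows "stable (M.span S)"
proof -
  note W = M.span_submodule[OF S]
  note Wc = M.submodule_subset[OF W]
  have "submodule {n \<in> M.span S. \<forall>x\<in>carrier G. action M x n \<in> M.span S} A M" (is "submodule ?Q A M")
  proof (rule M.submodule_criterion)
    fix a n assume "a \<in> carrier A" "n \<in> ?Q"
    then show "a \<odot>\<^bsub>M\<^esub> n \<in> ?Q"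
      using Wc by (auto simp: action_leibniz subset_iff anchor_closed M.submodule_smult[OF W]
          intro!: M.submodule_add[OF W])
  qed (use Wc in \<open>auto simp: action_zero action_sum subset_iff M.submodule_zero[OF W] M.submodule_add[OF W]\<close>)
  then have "M.span S \<subseteq> ?Q" by (rule M.span_least) (use act M.span_superset in auto)
  then show ?thesis using W by (auto simp: gsubmodule_def)
qed

lemma stable_span_Un:
  assumes "stable N" "stable L"
  shows "stable (M.span (N \<union> L))"
proof (rule stable_span)
  show "N \<union> L \<subseteq> carrier M" using assms M.submodule_subset stable_submodule by blast
  show "action M x s \<in> M.span (N \<union> L)" if "x \<in> carrier G" "s \<in> N \<union> L" for x s
    using that stable_action assms M.span_superset[of "N \<union> L"] by blast
qed

lemma stable_Int: "\<lbrakk>stable N; stable L\<rbrakk> \<Longrightarrow> stable (N \<inter> L)"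
  by (auto simp: gsubmodule_def M.submodule_Int)

lemma stable_imul:
  assumes I: "stable_ideal A G I" and N: "stable N"
  shows "stable (M.imul I N)"
proof -
  have Ic: "I \<subseteq> carrier A" using I by (auto simp: stable_ideal_def ideal.Icarr)
  note Nc = M.submodule_subset[OF stable_submodule[OF N]]
  let ?S = "{a \<odot>\<^bsub>M\<^esub> n | a n. a \<in> I \<and> n \<in> N}"
  have S: "?S \<subseteq> carrier M" using Ic Nc by auto
  note W = M.span_submodule[OF S]
  show ?thesis unfolding ideal_mult_submodule_def
  proof (rule stable_span[OF S])
    fix x s assume x: "x \<in> carrier G" and "s \<in> ?S"
    then obtain a n where an: "s = a \<odot>\<^bsub>M\<^esub> n" "a \<in> I" "n \<in> N" by auto
    then have "action M x s = anchor G x a \<odot>\<^bsub>M\<^esub> n \<oplus>\<^bsub>M\<^esub> a \<odot>\<^bsub>M\<^esub> action M x n"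
      using x Ic Nc by (auto simp: action_leibniz subset_iff)
    moreover have "anchor G x a \<in> I" using an x I by (auto simp: stable_ideal_def)
    then have "anchor G x a \<odot>\<^bsub>M\<^esub> n \<in> ?S" "a \<odot>\<^bsub>M\<^esub> action M x n \<in> ?S"
      using an x stable_action[OF N] by blast+
    ultimately show "action M x s \<in> M.span ?S"
      using M.span_superset[of ?S] by (auto intro: M.submodule_add[OF W])
  qed
qed

lemma stable_funpow_imul:
  "\<lbrakk>stable_ideal A G I; stable N\<rbrakk> \<Longrightarrow> stable ((M.imul I ^^ t) N)"
  by (induction t) (auto simp: stable_imul)

text \<open>
  Up to an element of \<open>I L\<close>, an element of the Lie algebroid acts on a linear combination with
  coefficients in \<open>I\<close> by differentiating the coefficients.
\<close>

lemma action_lincomb: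
  assumes S: "finite S" "S \<subseteq> L" and L: "stable L" and I: "ideal I A" and c: "c \<in> S \<rightarrow> I" and x: "x \<in> carrier G"
  obtains y where "y \<in> M.imul I L"
    "action M x (M.lincomb S c) = M.lincomb S (\<lambda>s. anchor G x (c s)) \<oplus>\<^bsub>M\<^esub> y"
proof -
  have Ic: "I \<subseteq> carrier A" using I by (auto simp: ideal.Icarr)
  note Lc = M.submodule_subset[OF stable_submodule[OF L]]
  have IL: "submodule (M.imul I L) A M" by (rule M.imul_submodule[OF Ic Lc])
  note ILc = M.submodule_subset[OF IL]
  have "\<exists>y\<in>M.imul I L. action M x (M.lincomb S c) = M.lincomb S (\<lambda>s. anchor G x (c s)) \<oplus>\<^bsub>M\<^esub> y"
    using S c
  proof (induction S)
    case empty
    show ?case using x by (auto simp: action_zero intro!: bexI[of _ "\<zero>\<^bsub>M\<^esub>"] M.submodule_zero[OF IL])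
  next
    case (insert s S)
    then obtain y where y: "y \<in> M.imul I L"
      "action M x (M.lincomb S c) = M.lincomb S (\<lambda>s. anchor G x (c s)) \<oplus>\<^bsub>M\<^esub> y" by auto
    have cs: "c s \<in> I" "c s \<in> carrier A" "s \<in> L" "s \<in> carrier M" using insert.prems Ic Lc by auto
    have Sc: "S \<subseteq> carrier M" "c \<in> S \<rightarrow> carrier A" using insert.prems Ic Lc by auto
    have Dc: "(\<lambda>s. anchor G x (c s)) \<in> S \<rightarrow> carrier A" using Sc x by (auto simp: anchor_closed Pi_iff)
    have ys: "c s \<odot>\<^bsub>M\<^esub> action M x s \<in> M.imul I L"
      using cs stable_action[OF L x] by (intro M.imul_memI) auto
    have "M.lincomb (insert s S) c = c s \<odot>\<^bsub>M\<^esub> s \<oplus>\<^bsub>M\<^esub> M.lincomb S c"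
      using insert.hyps cs Sc by (intro M.lincomb_insert) auto
    then have "action M x (M.lincomb (insert s S) c) =
      (anchor G x (c s) \<odot>\<^bsub>M\<^esub> s \<oplus>\<^bsub>M\<^esub> c s \<odot>\<^bsub>M\<^esub> action M x s) \<oplus>\<^bsub>M\<^esub>
        (M.lincomb S (\<lambda>s. anchor G x (c s)) \<oplus>\<^bsub>M\<^esub> y)"
      using cs x M.lincomb_closed[OF Sc] y by (simp add: action_sum action_leibniz)
    also have "\<dots> = (anchor G x (c s) \<odot>\<^bsub>M\<^esub> s \<oplus>\<^bsub>M\<^esub> M.lincomb S (\<lambda>s. anchor G x (c s))) \<oplus>\<^bsub>M\<^esub>
        (c s \<odot>\<^bsub>M\<^esub> action M x s \<oplus>\<^bsub>M\<^esub> y)"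
      using cs x M.lincomb_closed[OF Sc(1) Dc] y ILc
      by (simp add: M.M.add.m_ac subset_iff action_closed anchor_closed)
    also have "anchor G x (c s) \<odot>\<^bsub>M\<^esub> s \<oplus>\<^bsub>M\<^esub> M.lincomb S (\<lambda>s. anchor G x (c s)) =
        M.lincomb (insert s S) (\<lambda>s. anchor G x (c s))"
      using insert.hyps cs Sc Dc x by (intro M.lincomb_insert[symmetric]) (auto simp: anchor_closed)
    finally show ?case using M.submodule_add[OF IL ys y(1)] by blast
  qed
  then show thesis using that by blast
qed

text \<open>
  If \<open>L\<close> is generated modulo the stable submodule \<open>U\<close> by a set with the least number of elements,
  then every relation among these generators has its coefficients in the largest stable ideal \<open>P\<close>;
  if \<open>P L \<subseteq> U\<close>, this says that \<open>L/(U \<inter> L)\<close> is free over \<open>A/P\<close>.  Indeed let \<open>I\<close> be the ideal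
  generated by the coefficients of all relations.  Applying the action to a relation gives
  a relation whose coefficients agree modulo \<open>I\<close> with the differentiated ones, so \<open>I\<close> is stable.
  By minimality no coefficient is a unit; as \<open>m\<close> contains all non-units, \<open>I \<subseteq> m\<close> is proper.
\<close>

lemma minimal_relation_stable:
  assumes m: "ideal m A" "m \<noteq> carrier A" and units: "carrier A - m \<subseteq> Units A"
    and U: "stable U" and L: "stable L"
    and gen: "M.generates_mod U L S" and min: "card S = M.num_gens U L"
    and c: "c \<in> S \<rightarrow> carrier A" and rel: "M.lincomb S c \<in> U" and s: "s \<in> S"
  shows "c s \<in> largest_stable"
proof -
  note Usub = stable_submodule[OF U] and Lsub = stable_submodule[OF L]
  note Lc = M.submodule_subset[OF Lsub] and Uc = M.submodule_subset[OF Usub]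
  have S: "finite S" "S \<subseteq> L" "S \<subseteq> carrier M" "L \<subseteq> M.span (U \<union> S)"
    using gen Lc by (auto simp: M.generates_mod_def)
  define C where "C = {c t | c t. c \<in> S \<rightarrow> carrier A \<and> M.lincomb S c \<in> U \<and> t \<in> S}"
  have Cc: "C \<subseteq> carrier A" by (auto simp: C_def)
  have Cm: "C \<subseteq> m"
  proof
    fix r assume "r \<in> C"
    then obtain d t where d: "r = d t" "d \<in> S \<rightarrow> carrier A" "M.lincomb S d \<in> U" "t \<in> S" by (auto simp: C_def)
    then have "r \<notin> Units A" using M.minimal_relation_nonunit[OF Usub Lc gen min d(2,3,4)] by simp
    moreover have "r \<in> carrier A" using d by auto
    ultimately show "r \<in> m" using units by auto
  qed
  define I where "I = genideal A C"
  have I: "ideal I A" unfolding I_def by (rule M.R.genideal_ideal[OF Cc])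
  have CI: "C \<subseteq> I" unfolding I_def by (rule M.R.genideal_self[OF Cc])
  have Ic: "I \<subseteq> carrier A" using I by (auto simp: ideal.Icarr)
  have "I \<subseteq> m" unfolding I_def by (rule M.R.genideal_minimal[OF m(1) Cm])
  then have proper: "I \<noteq> carrier A" using m Ic by (metis ideal.Icarr subset_antisym subsetI)
  have "stable_ideal A G (genideal A C)"
  proof (rule stable_genideal[OF Cc])
    fix x r assume x: "x \<in> carrier G" and "r \<in> C"
    then obtain d t where d: "r = d t" "d \<in> S \<rightarrow> carrier A" "M.lincomb S d \<in> U" "t \<in> S" by (auto simp: C_def)
    have dI: "d \<in> S \<rightarrow> I" using d CI by (auto simp: C_def)
    obtain y where y: "y \<in> M.imul I L"
      "action M x (M.lincomb S d) = M.lincomb S (\<lambda>s. anchor G x (d s)) \<oplus>\<^bsub>M\<^esub> y"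
      by (rule action_lincomb[OF S(1,2) L I dI x])
    \<comment> \<open>as \<open>y\<close> is in \<open>I L\<close>, it is \<open>lincomb S e\<close> modulo \<open>U\<close> with \<open>e\<close> in \<open>I\<close>: the sum of \<open>e\<close> and the
      differentiated coefficients is again a relation\<close>
    obtain u e where e: "u \<in> U" "e \<in> S \<rightarrow> I" "y = u \<oplus>\<^bsub>M\<^esub> M.lincomb S e"
      by (rule M.imul_lincomb[OF Usub S(1,3) I S(4) y(1)])
    have ec: "e \<in> S \<rightarrow> carrier A" and Dc: "(\<lambda>s. anchor G x (d s)) \<in> S \<rightarrow> carrier A"
      using e Ic d x by (auto simp: anchor_closed Pi_iff)
    let ?f = "\<lambda>s. anchor G x (d s) \<oplus>\<^bsub>A\<^esub> e s"
    have "M.lincomb S ?f = M.lincomb S (\<lambda>s. anchor G x (d s)) \<oplus>\<^bsub>M\<^esub> M.lincomb S e"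
      by (rule M.lincomb_add[OF S(3) Dc ec])
    also have "\<dots> = action M x (M.lincomb S d) \<ominus>\<^bsub>M\<^esub> u"
      using y e Uc M.lincomb_closed[OF S(3) ec] M.lincomb_closed[OF S(3) Dc]
      by (simp add: a_minus_def M.M.add.m_ac subset_iff M.M.r_neg M.M.r_neg1 M.M.r_neg2)
    also have "\<dots> \<in> U" using stable_action[OF U x] d e by (intro M.submodule_diff[OF Usub]) auto
    finally have "M.lincomb S ?f \<in> U" .
    moreover have "?f \<in> S \<rightarrow> carrier A" using Dc ec by auto
    ultimately have "?f t \<in> C"
      unfolding C_def using d(4) by (intro CollectI exI[of _ ?f] exI[of _ t]) simp
    then have "?f t \<ominus>\<^bsub>A\<^esub> e t \<in> I" using CI e d I
      by (auto simp: a_minus_def Pi_iff ideal_def additive_subgroup.a_closed additive_subgroup.a_inv_closed)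
    moreover have "?f t \<ominus>\<^bsub>A\<^esub> e t = anchor G x r"
      using d e ec Dc by (auto simp: a_minus_def M.R.add.m_assoc M.R.r_neg Pi_iff)
    ultimately show "anchor G x r \<in> genideal A C" by (simp add: I_def)
  qed
  then have "I \<subseteq> largest_stable" using largest_stable_upper proper by (simp add: I_def)
  moreover have "c s \<in> C" using c rel s by (auto simp: C_def)
  ultimately show ?thesis using CI by auto
qed

section \<open>Heights of intervals of stable submodules\<close>

text \<open>
  Finiteness of the length of the interval from \<open>N\<close> to \<open>L\<close> in the lattice of stable submodules,
  witnessed by a bounded, strictly increasing function \<open>h\<close> on the interval.  Such functions are
  easier to combine than chains.
\<close>

definition finite_height :: "'m set \<Rightarrow> 'm set \<Rightarrow> bool"
  where "finite_height N L \<longleftrightarrow> (\<exists>(h :: 'm set \<Rightarrow> nat) b. \<forall>U. stable U \<and> N \<subseteq> U \<and> U \<subseteq> L \<longrightarrow>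
    h U \<le> b \<and> (\<forall>V. stable V \<and> U \<subset> V \<and> V \<subseteq> L \<longrightarrow> h U < h V))"

lemma finite_height_refl: "finite_height L L"
  unfolding finite_height_def by (intro exI[of _ "\<lambda>_. 0"] exI[of _ 0]) auto

lemma finite_height_mono: "\<lbrakk>finite_height N L; N \<subseteq> N'\<rbrakk> \<Longrightarrow> finite_height N' L"
  unfolding finite_height_def by (meson subset_trans)

text \<open>
  The heights \<open>h\<close> on \<open>[N, W]\<close> and \<open>g\<close> on \<open>[W, L]\<close> combine to \<open>h (U \<inter> W) + g (U + W)\<close>, which is
  strictly increasing by modularity.
\<close>

lemma finite_height_trans:
  assumes NK: "finite_height N W" and KL: "finite_height W L"
    and st: "stable W" "stable L" and sub: "N \<subseteq> W" "W \<subseteq> L"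
  shows "finite_height N L"
proof -
  from NK obtain h b where hb: "\<forall>U. stable U \<and> N \<subseteq> U \<and> U \<subseteq> W \<longrightarrow>
      h U \<le> (b::nat) \<and> (\<forall>V. stable V \<and> U \<subset> V \<and> V \<subseteq> W \<longrightarrow> h U < h V)"
    unfolding finite_height_def by (elim exE)
  have h: "h U < h V" if "stable U" "N \<subseteq> U" "stable V" "U \<subset> V" "V \<subseteq> W" for U V
    using hb that by (metis order.trans psubset_imp_subset)
  from KL obtain g a where ga: "\<forall>U. stable U \<and> W \<subseteq> U \<and> U \<subseteq> L \<longrightarrow>
      g U \<le> (a::nat) \<and> (\<forall>V. stable V \<and> U \<subset> V \<and> V \<subseteq> L \<longrightarrow> g U < g V)"
    unfolding finite_height_def by (elim exE)
  have g: "g U < g V" if "stable U" "W \<subseteq> U" "stable V" "U \<subset> V" "V \<subseteq> L" for U V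
    using ga that by (metis order.trans psubset_imp_subset)
  define f where "f U = h (U \<inter> W) + g (M.span (U \<union> W))" for U
  have sumL: "stable (M.span (U \<union> W))" "W \<subseteq> M.span (U \<union> W)" "M.span (U \<union> W) \<subseteq> L"
    if "stable U" "U \<subseteq> L" for U
    using that st sub stable_span_Un M.span_superset[of "U \<union> W"] 
      M.span_least[OF stable_submodule[OF st(2)], of "U \<union> W"] by auto
  have intK: "stable (U \<inter> W)" "N \<subseteq> U \<inter> W" if "stable U" "N \<subseteq> U" for U
    using that st sub stable_Int by auto
  have "f U \<le> b + a" if "stable U" "N \<subseteq> U" "U \<subseteq> L" for U
    unfolding f_def using hb[rule_format, of "U \<inter> W"] ga[rule_format, of "M.span (U \<union> W)"] sumL[of U] intK[of U] that
    by (intro add_mono) auto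
  moreover have "f U < f V" if U: "stable U" "N \<subseteq> U" and V: "stable V" "U \<subset> V" "V \<subseteq> L" for U V
  proof -
    have UL: "U \<subseteq> L" and NV: "N \<subseteq> V" using U V by auto
    have le1: "U \<inter> W \<subseteq> V \<inter> W" and le2: "M.span (U \<union> W) \<subseteq> M.span (V \<union> W)"
      using V M.span_mono[of "U \<union> W" "V \<union> W"] by auto
    have "U \<inter> W \<noteq> V \<inter> W \<or> M.span (U \<union> W) \<noteq> M.span (V \<union> W)"
      using M.modular_law[of U V W] U V st stable_submodule by blast
    moreover have "h (U \<inter> W) < h (V \<inter> W)" if "U \<inter> W \<noteq> V \<inter> W"
      using that le1 intK[OF U] intK[OF V(1) NV] by (intro h) auto
    moreover have "g (M.span (U \<union> W)) < g (M.span (V \<union> W))" if "M.span (U \<union> W) \<noteq> M.span (V \<union> W)"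
      using that le2 sumL[OF U(1) UL] sumL[OF V(1,3)] by (intro g) auto
    ultimately show ?thesis unfolding f_def
      by (cases "U \<inter> W = V \<inter> W"; cases "M.span (U \<union> W) = M.span (V \<union> W)") auto
  qed
  ultimately show ?thesis unfolding finite_height_def by blast
qed

text \<open>
  On stable submodules between \<open>P L\<close> and \<open>L\<close>, where \<open>P\<close> is the largest stable ideal, the number of
  generators of \<open>L\<close> modulo \<open>U\<close> strictly decreases as \<open>U\<close> grows.  If \<open>U \<subset> V\<close> had the same number, a
  minimal generating set \<open>T\<close> for \<open>U\<close> would be minimal for \<open>V\<close>; an element of \<open>V\<close>, written modulo \<open>U\<close>
  as a combination of \<open>T\<close>, would give a relation modulo \<open>V\<close>, so its coefficients would be in \<open>P\<close>,
  and the element would lie in \<open>U + P L = U\<close>.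
\<close>

lemma finite_height_layer:
  assumes m: "ideal m A" "m \<noteq> carrier A" and units: "carrier A - m \<subseteq> Units A"
    and L: "stable (M.span S)" and S: "finite S" "S \<subseteq> carrier M"
  shows "finite_height (M.imul largest_stable (M.span S)) (M.span S)"
proof -
  let ?L = "M.span S" and ?P = largest_stable
  note Lsub = stable_submodule[OF L]
  have Pc: "?P \<subseteq> carrier A" using largest_stable_stable by (auto simp: stable_ideal_def ideal.Icarr)
  have gen: "M.generates_mod U ?L S" for U
    using S M.span_superset[of S] M.span_mono[of S "U \<union> S"] by (auto simp: M.generates_mod_def)
  define h where "h U = card S - M.num_gens U ?L" for U
  have "h U < h V" if U: "stable U" "M.imul ?P ?L \<subseteq> U" and V: "stable V" "U \<subset> V" "V \<subseteq> ?L" for U V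
  proof -
    obtain T where T: "M.generates_mod U ?L T" "card T = M.num_gens U ?L"
      by (rule M.num_gens_attained[OF gen])
    have TV: "M.generates_mod V ?L T" using M.generates_mod_mono[OF T(1)] V by auto
    have Tc: "finite T" "T \<subseteq> ?L" "T \<subseteq> carrier M" "?L \<subseteq> M.span (U \<union> T)"
      using T(1) M.submodule_subset[OF Lsub] by (auto simp: M.generates_mod_def)
    have "M.num_gens V ?L \<noteq> card T"
    proof
      assume eq: "M.num_gens V ?L = card T"
      have "V \<subseteq> U"
      proof
        fix v assume v: "v \<in> V"
        then have "v \<in> M.span (U \<union> T)" using Tc V by auto
        then obtain u c where uc: "u \<in> U" "c \<in> T \<rightarrow> carrier A" "v = u \<oplus>\<^bsub>M\<^esub> M.lincomb T c"
          by (rule M.span_Un_lincomb[OF stable_submodule[OF U(1)] Tc(1,3)])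
        have carr: "u \<in> carrier M" "M.lincomb T c \<in> carrier M" 
          using uc M.submodule_subset[OF stable_submodule[OF U(1)]] M.lincomb_closed[OF Tc(3)] by auto
        have "M.lincomb T c = v \<ominus>\<^bsub>M\<^esub> u"
          unfolding uc(3) using carr by (simp add: a_minus_def M.M.add.m_ac M.M.r_neg M.M.r_neg1 M.M.r_neg2)
        moreover have "v \<ominus>\<^bsub>M\<^esub> u \<in> V" using v uc(1) V by (intro M.submodule_diff[OF stable_submodule[OF V(1)]]) auto
        ultimately have "M.lincomb T c \<in> V" by simp
        then have "c t \<in> ?P" if "t \<in> T" for t
          using minimal_relation_stable[OF m units V(1) L TV eq[symmetric] uc(2) _ that] by simp
        then have "M.lincomb T c \<in> M.imul ?P ?L"
          using Tc uc Pc by (intro M.lincomb_submodule[OF M.imul_submodule] M.imul_memI)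
            (auto dest: M.submodule_subset[OF Lsub, THEN subsetD])
        then show "v \<in> U" using uc U M.submodule_add[OF stable_submodule[OF U(1)]] by auto
      qed
      then show False using V by auto
    qed
    then have "M.num_gens V ?L < M.num_gens U ?L" using M.num_gens_le[OF TV] T(2) by simp
    then show ?thesis unfolding h_def using M.num_gens_le[OF gen, of U] by simp
  qed
  moreover have "h U \<le> card S" for U by (simp add: h_def)
  ultimately show ?thesis unfolding finite_height_def by blast
qed

lemma funpow_imul_finitely_generated:
  assumes T: "finite T" "T \<subseteq> carrier A" "P = genideal A T"
    and S: "finite S" "S \<subseteq> carrier M" "M.span S = carrier M"
  shows "\<exists>B. finite B \<and> B \<subseteq> carrier M \<and> (M.imul P ^^ t) (carrier M) = M.span B"
proof (induction t)
  case (Suc t)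
  then obtain B where "finite B" "B \<subseteq> carrier M" "(M.imul P ^^ t) (carrier M) = M.span B" by auto
  then show ?case using M.imul_finitely_generated[OF T(1,2), of B] by (simp add: T(3))
qed (use S in auto)

lemma finite_height_powers:
  assumes m: "ideal m A" "m \<noteq> carrier A" and units: "carrier A - m \<subseteq> Units A"
    and T: "finite T" "T \<subseteq> carrier A" "largest_stable = genideal A T"
    and S: "finite S" "S \<subseteq> carrier M" "M.span S = carrier M"
  shows "finite_height ((M.imul largest_stable ^^ t) (carrier M)) (carrier M)"
proof -
  let ?P = largest_stable
  have Pc: "?P \<subseteq> carrier A" using largest_stable_stable by (auto simp: stable_ideal_def ideal.Icarr)
  define L where "L t = (M.imul ?P ^^ t) (carrier M)" for t
  have st: "stable (L t)" for t
    unfolding L_def by (rule stable_funpow_imul[OF largest_stable_stable stable_carrier])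
  have "finite_height (L t) (carrier M)"
  proof (induction t)
    case (Suc t)
    obtain B where B: "finite B" "B \<subseteq> carrier M" "L t = M.span B"
      using funpow_imul_finitely_generated[OF T S] unfolding L_def by blast
    have "finite_height (L (Suc t)) (L t)"
      using finite_height_layer[OF m units _ B(1,2)] st[of t] B(3) by (simp add: L_def)
    moreover have "L (Suc t) \<subseteq> L t"
      unfolding L_def by (rule M.funpow_imul_subset[OF Pc M.carrier_is_submodule])
    ultimately show ?case
      using finite_height_trans[OF _ Suc st stable_carrier] M.submodule_subset[OF stable_submodule[OF st]]
      by simp
  qed (simp add: L_def finite_height_refl)
  then show ?thesis by (simp add: L_def)
qed

end

section \<open>Powers of stable ideals\<close>

lemma (in lie_algebroid) stable_ideal_subset: "stable_ideal A G I \<Longrightarrow> I \<subseteq> carrier A"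
  by (auto simp: stable_ideal_def ideal.Icarr)

lemma (in lie_algebroid) stable_ideal_prod:
  assumes I: "stable_ideal A G I" and J: "stable_ideal A G J"
  shows "stable_ideal A G (ideal_prod A I J)"
proof -
  interpret A: cring A by (rule base_cring)
  have IJ: "ideal (ideal_prod A I J) A"
    using I J by (intro A.ideal_prod_is_ideal) (auto simp: stable_ideal_def)
  have "anchor G x r \<in> ideal_prod A I J" if x: "x \<in> carrier G" and r: "r \<in> ideal_prod A I J" for x r
    using r
  proof induction
    case (prod i j)
    then have "anchor G x (i \<otimes>\<^bsub>A\<^esub> j) = anchor G x i \<otimes>\<^bsub>A\<^esub> j \<oplus>\<^bsub>A\<^esub> i \<otimes>\<^bsub>A\<^esub> anchor G x j"
      using x stable_ideal_subset[OF I] stable_ideal_subset[OF J] by (intro anchor_mult) auto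
    then show ?case using prod x I J by (auto simp: stable_ideal_def intro!: ideal_prod.intros)
  next
    case (sum r s)
    then have "r \<in> carrier A" "s \<in> carrier A" using IJ by (auto simp: ideal.Icarr)
    then show ?case using sum x by (auto simp: anchor_sum intro: ideal_prod.sum)
  qed
  with IJ show ?thesis by (simp add: stable_ideal_def)
qed

lemma ideals_set_one [simp]: "one (ideals_set A) = carrier A"
  by (simp add: ideals_set_def)

lemma ideals_set_mult [simp]: "monoid.mult (ideals_set A) = ideal_prod A"
  by (simp add: ideals_set_def)

lemma (in lie_algebroid) stable_ideal_power:
  assumes J: "stable_ideal A G J"
  shows "stable_ideal A G (ideal_power A J n)"
proof (induction n)
  case 0
  interpret A: cring A by (rule base_cring)
  show ?case by (simp add: stable_ideal_def A.oneideal anchor_closed)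
next
  case (Suc n)
  then show ?case by (simp add: stable_ideal_prod J)
qed

lemma (in module) funpow_imul_ideal_power:
  assumes J: "ideal J R"
  shows "(imul J ^^ n) (carrier M) \<subseteq> imul (ideal_power R J n) (carrier M)"
proof (induction n)
  case 0
  have "m \<in> imul (carrier R) (carrier M)" if "m \<in> carrier M" for m
    using imul_memI[OF R.one_closed that] that by simp
  then show ?case by auto
next
  case (Suc n)
  have Jc: "J \<subseteq> carrier R" using J by (auto simp: ideal.Icarr)
  have Jn: "ideal (ideal_power R J n) R" for n
    by (induction n) (simp_all add: R.oneideal R.ideal_prod_is_ideal J)
  then have Jnc: "ideal_power R J n \<subseteq> carrier R" for n by (meson ideal.Icarr subsetI)
  let ?W = "imul (ideal_power R J (Suc n)) (carrier M)"
  have W: "submodule ?W R M" by (rule imul_submodule[OF Jnc]) auto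
  have "imul J (imul (ideal_power R J n) (carrier M)) \<subseteq> ?W"
  proof (rule imul_least[OF W])
    fix a y assume a: "a \<in> J" and y: "y \<in> imul (ideal_power R J n) (carrier M)"
    have "imul (ideal_power R J n) (carrier M) \<subseteq> {x \<in> carrier M. a \<odot>\<^bsub>M\<^esub> x \<in> ?W}"
    proof (rule imul_least)
      show "submodule {x \<in> carrier M. a \<odot>\<^bsub>M\<^esub> x \<in> ?W} R M" using a Jc W by (intro submodule_colon) auto
      fix b m assume b: "b \<in> ideal_power R J n" and m: "m \<in> carrier M"
      have "a \<odot>\<^bsub>M\<^esub> (b \<odot>\<^bsub>M\<^esub> m) = (b \<otimes>\<^bsub>R\<^esub> a) \<odot>\<^bsub>M\<^esub> m"
        using a b m Jc Jnc[of n] by (simp add: smult_assoc1[symmetric] R.m_comm subset_iff)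
      moreover have "b \<otimes>\<^bsub>R\<^esub> a \<in> ideal_power R J (Suc n)" using a b by (simp add: ideal_prod.prod)
      ultimately have "a \<odot>\<^bsub>M\<^esub> (b \<odot>\<^bsub>M\<^esub> m) \<in> ?W" using imul_memI m by metis
      then show "b \<odot>\<^bsub>M\<^esub> m \<in> {x \<in> carrier M. a \<odot>\<^bsub>M\<^esub> x \<in> ?W}" using b m Jnc[of n] by auto
    qed
    then show "a \<odot>\<^bsub>M\<^esub> y \<in> ?W" using y by auto
  qed
  moreover have "(imul J ^^ Suc n) (carrier M) \<subseteq> imul J (imul (ideal_power R J n) (carrier M))"
    using Suc imul_mono[of J J] by simp
  ultimately show ?case by blast
qed

section \<open>Stable submodules of a quotient\<close>

context lie_algebroid_module
begin

lemma submodule_abelian_subgroup: "submodule N A M \<Longrightarrow> abelian_subgroup N M"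
  by (intro abelian_subgroupI3 additive_subgroup.intro) (auto simp: submodule_def M.M.abelian_group_axioms)

lemma coset_eq_iff:
  assumes N: "submodule N A M" and "x \<in> carrier M" "y \<in> carrier M"
  shows "N +>\<^bsub>M\<^esub> x = N +>\<^bsub>M\<^esub> y \<longleftrightarrow> x \<ominus>\<^bsub>M\<^esub> y \<in> N"
proof -
  interpret N: abelian_subgroup N M by (rule submodule_abelian_subgroup[OF N])
  have "N +>\<^bsub>M\<^esub> x = N +>\<^bsub>M\<^esub> y \<longleftrightarrow> x \<in> N +>\<^bsub>M\<^esub> y"
    using assms N.a_rcos_self N.a_repr_independence' by metis
  also have "\<dots> \<longleftrightarrow> x \<ominus>\<^bsub>M\<^esub> y \<in> N" using assms by (simp add: N.a_rcos_module a_minus_def)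
  finally show ?thesis .
qed

lemma quotient_carrier: "carrier (quotient_gmodule M N) = (\<lambda>x. N +>\<^bsub>M\<^esub> x) ` carrier M"
  by (auto simp: quotient_gmodule_def A_RCOSETS_def RCOSETS_def a_r_coset_def)

text \<open>
  The additive monoid of the quotient differs from the factor group only by the further fields of
  the record, which subgroups do not see.
\<close>

lemma quotient_subgroup_iff:
  "subgroup H (add_monoid (quotient_gmodule M N)) \<longleftrightarrow> subgroup H (M A_Mod N)"
  by (simp add: subgroup_def m_inv_def quotient_gmodule_def A_FactGroup_def')

lemma quotient_add:
  assumes "submodule N A M" "x \<in> carrier M" "y \<in> carrier M"
  shows "(N +>\<^bsub>M\<^esub> x) \<oplus>\<^bsub>quotient_gmodule M N\<^esub> (N +>\<^bsub>M\<^esub> y) = N +>\<^bsub>M\<^esub> (x \<oplus>\<^bsub>M\<^esub> y)"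
  using abelian_subgroup.a_rcos_sum[OF submodule_abelian_subgroup] assms
  by (simp add: quotient_gmodule_def)

text \<open>
  The unions over representatives that define the operations on the quotient are single cosets.
\<close>

lemma coset_UN_const:
  assumes N: "submodule N A M" and x: "x \<in> carrier M"
    and f: "\<And>m. m \<in> carrier M \<Longrightarrow> f m \<in> carrier M"
      "\<And>m n. \<lbrakk>m \<in> carrier M; n \<in> carrier M\<rbrakk> \<Longrightarrow> f (m \<oplus>\<^bsub>M\<^esub> n) = f m \<oplus>\<^bsub>M\<^esub> f n"
      "\<And>n. n \<in> N \<Longrightarrow> f n \<in> N"
  shows "(\<Union>m\<in>N +>\<^bsub>M\<^esub> x. N +>\<^bsub>M\<^esub> f m) = N +>\<^bsub>M\<^esub> f x"
proof -
  interpret N: abelian_subgroup N M by (rule submodule_abelian_subgroup[OF N])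
  have "N +>\<^bsub>M\<^esub> f m = N +>\<^bsub>M\<^esub> f x" if m: "m \<in> N +>\<^bsub>M\<^esub> x" for m
  proof -
    have mc: "m \<in> carrier M" using m x by (rule N.a_elemrcos_carrier[rotated])
    then have n: "m \<ominus>\<^bsub>M\<^esub> x \<in> N" using m x N.a_rcos_module by (simp add: a_minus_def)
    have "f m = f ((m \<ominus>\<^bsub>M\<^esub> x) \<oplus>\<^bsub>M\<^esub> x)" using mc x by (simp add: a_minus_def M.M.add.m_assoc M.M.l_neg)
    also have "\<dots> = f (m \<ominus>\<^bsub>M\<^esub> x) \<oplus>\<^bsub>M\<^esub> f x" using n x by (intro f(2)) auto
    finally have "f m \<ominus>\<^bsub>M\<^esub> f x = f (m \<ominus>\<^bsub>M\<^esub> x)"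
      using f(1)[OF x] f(3)[OF n] by (simp add: a_minus_def M.M.add.m_assoc M.M.r_neg)
    then show ?thesis using f(3)[OF n] coset_eq_iff[OF N f(1)[OF mc] f(1)[OF x]] by simp
  qed
  then show ?thesis using N.a_rcos_self[OF x] by blast
qed

lemma quotient_smult:
  assumes "submodule N A M" "a \<in> carrier A" "x \<in> carrier M"
  shows "a \<odot>\<^bsub>quotient_gmodule M N\<^esub> (N +>\<^bsub>M\<^esub> x) = N +>\<^bsub>M\<^esub> (a \<odot>\<^bsub>M\<^esub> x)"
  unfolding quotient_gmodule_def
  using coset_UN_const[OF assms(1,3), of "\<lambda>m. a \<odot>\<^bsub>M\<^esub> m"] assms M.submodule_smult
  by (simp add: M.smult_r_distr)

lemma quotient_action:
  assumes "stable N" "g \<in> carrier G" "x \<in> carrier M"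
  shows "action (quotient_gmodule M N) g (N +>\<^bsub>M\<^esub> x) = N +>\<^bsub>M\<^esub> action M g x"
  unfolding quotient_gmodule_def
  using coset_UN_const[OF stable_submodule[OF assms(1)] assms(3), of "action M g"] assms
  by (simp add: action_closed action_sum stable_action)

lemma stable_preimage:
  assumes N: "stable N" and H: "gsubmodule A G (quotient_gmodule M N) H"
  shows "stable {x \<in> carrier M. N +>\<^bsub>M\<^esub> x \<in> H}" "N \<subseteq> {x \<in> carrier M. N +>\<^bsub>M\<^esub> x \<in> H}"
    and "H = (\<lambda>x. N +>\<^bsub>M\<^esub> x) ` {x \<in> carrier M. N +>\<^bsub>M\<^esub> x \<in> H}"
proof -
  note Ns = stable_submodule[OF N]
  interpret N: abelian_subgroup N M by (rule submodule_abelian_subgroup[OF Ns])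
  let ?Q = "quotient_gmodule M N" and ?U = "{x \<in> carrier M. N +>\<^bsub>M\<^esub> x \<in> H}"
  have sub: "subgroup H (add_monoid ?Q)" and sm: "\<And>a C. \<lbrakk>a \<in> carrier A; C \<in> H\<rbrakk> \<Longrightarrow> a \<odot>\<^bsub>?Q\<^esub> C \<in> H"
    and ac: "\<And>x C. \<lbrakk>x \<in> carrier G; C \<in> H\<rbrakk> \<Longrightarrow> action ?Q x C \<in> H"
    using H by (auto simp: gsubmodule_def submodule_def submodule_axioms_def)
  have add: "C \<oplus>\<^bsub>?Q\<^esub> D \<in> H" if "C \<in> H" "D \<in> H" for C D
    using subgroup.m_closed[OF sub that] by simp
  have NH: "N \<in> H" using subgroup.one_closed[OF sub] by (simp add: quotient_gmodule_def)
  show NU: "N \<subseteq> ?U" using NH N.a_rcos_const by auto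
  have "submodule ?U A M"
  proof (rule M.submodule_criterion)
    show "\<zero>\<^bsub>M\<^esub> \<in> ?U" using NU N.zero_closed by blast
    show "x \<oplus>\<^bsub>M\<^esub> y \<in> ?U" if "x \<in> ?U" "y \<in> ?U" for x y
      using that add[of "N +>\<^bsub>M\<^esub> x" "N +>\<^bsub>M\<^esub> y"] by (simp add: quotient_add[OF Ns])
    show "a \<odot>\<^bsub>M\<^esub> x \<in> ?U" if "a \<in> carrier A" "x \<in> ?U" for a x
      using that sm[of a "N +>\<^bsub>M\<^esub> x"] by (simp add: quotient_smult[OF Ns])
  qed auto
  moreover have "action M g x \<in> ?U" if "g \<in> carrier G" "x \<in> ?U" for g x
    using that ac[of g "N +>\<^bsub>M\<^esub> x"] by (simp add: quotient_action[OF N] action_closed)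
  ultimately show "stable ?U" by (simp add: gsubmodule_def)
  have "H \<subseteq> carrier ?Q" using subgroup.subset[OF sub] by simp
  then show "H = (\<lambda>x. N +>\<^bsub>M\<^esub> x) ` ?U" by (auto simp: quotient_carrier)
qed

lemma stable_image:
  assumes N: "stable N" and U: "stable U"
  shows "gsubmodule A G (quotient_gmodule M N) ((\<lambda>x. N +>\<^bsub>M\<^esub> x) ` U)"
proof -
  note Ns = stable_submodule[OF N] and Us = stable_submodule[OF U]
  note Uc = M.submodule_subset[OF Us]
  interpret N: abelian_subgroup N M by (rule submodule_abelian_subgroup[OF Ns])
  let ?Q = "quotient_gmodule M N" and ?H = "(\<lambda>x. N +>\<^bsub>M\<^esub> x) ` U"
  have "subgroup ?H (M A_Mod N)"
  proof (rule group.subgroupI[OF N.a_factorgroup_is_group])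
    have c: "N +>\<^bsub>M\<^esub> x \<in> carrier (M A_Mod N)" if "x \<in> U" for x
      using that Uc quotient_carrier[of N] by (auto simp: A_FactGroup_def' quotient_gmodule_def)
    then show "?H \<subseteq> carrier (M A_Mod N)" by auto
    show "?H \<noteq> {}" using M.submodule_zero[OF Us] by auto
    fix C assume "C \<in> ?H"
    then obtain x where x: "C = N +>\<^bsub>M\<^esub> x" "x \<in> U" by auto
    then show "inv\<^bsub>M A_Mod N\<^esub> C \<in> ?H"
      using c Uc M.submodule_neg[OF Us] by (auto simp: N.a_inv_FactGroup N.a_rcos_inv)
    fix D assume "D \<in> ?H"
    then obtain y where y: "D = N +>\<^bsub>M\<^esub> y" "y \<in> U" by auto
    then have "C \<otimes>\<^bsub>M A_Mod N\<^esub> D = N +>\<^bsub>M\<^esub> (x \<oplus>\<^bsub>M\<^esub> y)"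
      using x Uc by (simp add: N.a_rcos_sum subset_iff)
    then show "C \<otimes>\<^bsub>M A_Mod N\<^esub> D \<in> ?H" using x y M.submodule_add[OF Us] by blast
  qed
  moreover have "a \<odot>\<^bsub>?Q\<^esub> C \<in> ?H" if "a \<in> carrier A" "C \<in> ?H" for a C
    using that Uc M.submodule_smult[OF Us] by (auto simp: quotient_smult[OF Ns] subset_iff)
  moreover have "action ?Q g C \<in> ?H" if "g \<in> carrier G" "C \<in> ?H" for g C
    using that Uc stable_action[OF U] by (auto simp: quotient_action[OF N] subset_iff)
  ultimately show ?thesis
    by (auto simp: gsubmodule_def submodule_def submodule_axioms_def quotient_subgroup_iff)
qed

section \<open>Finite length of quotients\<close>

lemma finite_glength_quotient:
  assumes N: "stable N" and fin: "finite_height N (carrier M)"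
  shows "glength A G (quotient_gmodule M N) < \<infinity>"
proof -
  let ?Q = "quotient_gmodule M N"
  from fin obtain h b where hb: "\<forall>U. stable U \<and> N \<subseteq> U \<and> U \<subseteq> carrier M \<longrightarrow>
      h U \<le> (b::nat) \<and> (\<forall>V. stable V \<and> U \<subset> V \<and> V \<subseteq> carrier M \<longrightarrow> h U < h V)"
    unfolding finite_height_def by (elim exE)
  have "n \<le> b" if H: "\<forall>i\<le>n. gsubmodule A G ?Q (H i)" and inc: "\<forall>i<n. H i \<subset> H (Suc i)" for n H
  proof -
    define U where "U i = {x \<in> carrier M. N +>\<^bsub>M\<^esub> x \<in> H i}" for i
    have st: "stable (U i)" "N \<subseteq> U i" "H i = (\<lambda>x. N +>\<^bsub>M\<^esub> x) ` U i" if "i \<le> n" for i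
      using stable_preimage[OF N] H that by (auto simp: U_def)
    have Uc: "U i \<subseteq> carrier M" for i by (auto simp: U_def)
    have "i \<le> n \<Longrightarrow> i \<le> h (U i)" for i
    proof (induction i)
      case (Suc i)
      have "H i \<subset> H (Suc i)" using inc Suc.prems by simp
      moreover from this have "U i \<subseteq> U (Suc i)" by (auto simp: U_def)
      ultimately have "U i \<subset> U (Suc i)" using st(3)[of i] st(3)[of "Suc i"] Suc.prems by auto
      then have "h (U i) < h (U (Suc i))" using hb st[of i] st[of "Suc i"] Uc Suc.prems by simp
      then show ?case using Suc by simp
    qed simp
    then have "n \<le> h (U n)" by simp
    also have "\<dots> \<le> b" using hb st[of n] Uc by simp
    finally show ?thesis .
  qed
  then have "glength A G ?Q \<le> enat b"
    unfolding glength_def by (intro Sup_least) auto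
  then show ?thesis by (metis enat_ord_simps(4) infinity_ileE not_infinity_eq order_le_less)
qed

lemma decreasing_stabilizes:
  assumes N: "stable N" and fin: "glength A G (quotient_gmodule M N) < \<infinity>"
    and D: "\<And>i. stable (D i)" "\<And>i. N \<subseteq> D i" "\<And>i. D (Suc i) \<subseteq> D i"
  shows "\<exists>i. D (Suc i) = D i"
proof (rule ccontr)
  assume "\<not> ?thesis"
  then have strict: "D (Suc i) \<subset> D i" for i using D(3) by auto
  note Ns = stable_submodule[OF N]
  let ?Q = "quotient_gmodule M N"
  obtain b where b: "glength A G ?Q = enat b" using fin by (metis not_infinity_eq order_less_irrefl)
  \<comment> \<open>the first \<open>n\<close> strict inclusions, read backwards and modulo \<open>N\<close>, are a chain longer than the length\<close>
  define n where "n = Suc b"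
  define H where "H i = (\<lambda>x. N +>\<^bsub>M\<^esub> x) ` D (n - i)" for i
  have "H i \<subset> H (Suc i)" if i: "i < n" for i
  proof -
    define j where "j = n - Suc i"
    have ij: "n - i = Suc j" "n - Suc i = j" using i by (auto simp: j_def)
    obtain y where y: "y \<in> D j" "y \<notin> D (Suc j)" using strict[of j] by auto
    have "N +>\<^bsub>M\<^esub> y \<notin> H i"
    proof
      assume "N +>\<^bsub>M\<^esub> y \<in> H i"
      then obtain x where x: "x \<in> D (Suc j)" "N +>\<^bsub>M\<^esub> y = N +>\<^bsub>M\<^esub> x" by (auto simp: H_def ij)
      note Ds = stable_submodule[OF D(1)]
      have c: "x \<in> carrier M" "y \<in> carrier M" using x y M.submodule_subset[OF Ds] by auto
      then have "y \<ominus>\<^bsub>M\<^esub> x \<in> D (Suc j)" using x coset_eq_iff[OF Ns] D(2) by blast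
      then have "(y \<ominus>\<^bsub>M\<^esub> x) \<oplus>\<^bsub>M\<^esub> x \<in> D (Suc j)" using x M.submodule_add[OF Ds] by blast
      then show False using c y by (simp add: a_minus_def M.M.add.m_assoc M.M.l_neg)
    qed
    moreover have "N +>\<^bsub>M\<^esub> y \<in> H (Suc i)" using y by (auto simp: H_def ij)
    moreover have "H i \<subseteq> H (Suc i)" using D(3)[of j] by (auto simp: H_def ij)
    ultimately show ?thesis by auto
  qed
  moreover have "gsubmodule A G ?Q (H i)" for i unfolding H_def by (rule stable_image[OF N D(1)])
  ultimately have "enat n \<in> {enat n | n. \<exists>N. (\<forall>i\<le>n. gsubmodule A G ?Q (N i)) \<and> (\<forall>i<n. N i \<subset> N (Suc i))}"
    by blast
  then have "enat n \<le> glength A G ?Q" unfolding glength_def by (rule Sup_upper)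
  then show False using b by (simp add: n_def)
qed

text \<open>
  If \<open>M/N\<close> has finite length, then it is annihilated by a power of the largest stable ideal \<open>P\<close>: the
  submodules \<open>N + P\<^sup>i M\<close> become stationary, and the Nakayama lemma applies to \<open>P\<^sup>i M\<close>.
\<close>

lemma power_subset_of_finite_glength:
  assumes m: "ideal m A" "m \<noteq> carrier A" and units: "carrier A - m \<subseteq> Units A"
    and Pm: "largest_stable \<subseteq> m"
    and T: "finite T" "T \<subseteq> carrier A" "largest_stable = genideal A T"
    and S: "finite S" "S \<subseteq> carrier M" "M.span S = carrier M"
    and N: "stable N" and fin: "glength A G (quotient_gmodule M N) < \<infinity>"
  shows "\<exists>t. (M.imul largest_stable ^^ t) (carrier M) \<subseteq> N"
proof -
  let ?P = largest_stable
  note Pc = stable_ideal_subset[OF largest_stable_stable]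
  define L where "L t = (M.imul ?P ^^ t) (carrier M)" for t
  have st: "stable (L t)" for t
    unfolding L_def by (rule stable_funpow_imul[OF largest_stable_stable stable_carrier])
  have dec: "L (Suc t) \<subseteq> L t" for t
    unfolding L_def by (rule M.funpow_imul_subset[OF Pc M.carrier_is_submodule])
  have "\<exists>i. M.span (N \<union> L (Suc i)) = M.span (N \<union> L i)"
  proof (rule decreasing_stabilizes[OF N fin])
    show "stable (M.span (N \<union> L i))" for i by (rule stable_span_Un[OF N st])
    show "N \<subseteq> M.span (N \<union> L i)" for i using M.span_superset[of "N \<union> L i"] by auto
    show "M.span (N \<union> L (Suc i)) \<subseteq> M.span (N \<union> L i)" for i using dec by (intro M.span_mono) auto
  qed
  then obtain i where i: "M.span (N \<union> L (Suc i)) = M.span (N \<union> L i)" by auto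
  obtain B where B: "finite B" "B \<subseteq> carrier M" "L i = M.span B"
    using funpow_imul_finitely_generated[OF T S] unfolding L_def by blast
  have le: "M.span B \<subseteq> M.span (N \<union> M.imul ?P (M.span B))"
    using i M.span_superset[of "N \<union> L i"] by (simp add: L_def B(3)[unfolded L_def])
  have P: "ideal ?P A" using largest_stable_stable by (simp add: stable_ideal_def)
  have "M.span B \<subseteq> N"
    by (rule M.nakayama[OF m units P Pm stable_submodule[OF N] B(1,2) le])
  then show ?thesis using B by (auto simp: L_def)
qed

end

section \<open>The base ring as a module over the Lie algebroid\<close>

context lie_algebroid
begin

lemma base_gmodule_simps [simp]:
  "carrier (base_gmodule A G) = carrier A"
  "ring.zero (base_gmodule A G) = \<zero>\<^bsub>A\<^esub>"
  "add (base_gmodule A G) = add A"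
  "smult (base_gmodule A G) = monoid.mult A"
  "action (base_gmodule A G) = anchor G"
  by (simp_all add: base_gmodule_def)

lemma base_gmodule_minus: "\<lbrakk>x \<in> carrier A; y \<in> carrier A\<rbrakk> \<Longrightarrow> x \<ominus>\<^bsub>base_gmodule A G\<^esub> y = x \<ominus>\<^bsub>A\<^esub> y"
  by (simp add: a_minus_def a_inv_def m_inv_def)

lemma base_gmodule_module: "lie_algebroid_module K A G (base_gmodule A G)"
proof -
  interpret A: cring A by (rule base_cring)
  interpret KA: algebra K A by (rule base_algebra)
  have "Module.module A (base_gmodule A G)"
  proof (rule moduleI)
    show "abelian_group (base_gmodule A G)"
      by (rule abelian_groupI) (auto simp: A.add.m_ac intro: A.add.l_inv_ex)
  qed (auto simp: A.l_distr A.r_distr A.m_assoc A.cring_axioms)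
  moreover have "action (base_gmodule A G) x \<in> linear_endos K (restrict_scalars A (base_gmodule A G))"
    if "x \<in> carrier G" for x
    using anchor_derivation[OF that]
    by (auto simp: derivations_def linear_endos_def restrict_scalars_def KA.smult_assoc2 Pi_iff)
  ultimately have "lie_algebroid_module_axioms K A G (base_gmodule A G)"
    by (rule lie_algebroid_module_axioms.intro)
      (simp_all add: anchor_add anchor_smult anchor_bracket anchor_mult anchor_closed commutator_def base_gmodule_minus)
  then show ?thesis by (rule lie_algebroid_module.intro[OF lie_algebroid_axioms])
qed

lemma base_gmodule_span: "module_span A (base_gmodule A G) {\<one>\<^bsub>A\<^esub>} = carrier A"
proof -
  interpret B: lie_algebroid_module K A G "base_gmodule A G" by (rule base_gmodule_module)
  interpret A: cring A by (rule base_cring)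
  have s: "submodule (B.M.span {\<one>\<^bsub>A\<^esub>}) A (base_gmodule A G)" by (rule B.M.span_submodule) simp
  have "r \<in> B.M.span {\<one>\<^bsub>A\<^esub>}" if "r \<in> carrier A" for r
    using B.M.submodule_smult[OF s that, of "\<one>\<^bsub>A\<^esub>"] B.M.span_superset[of "{\<one>\<^bsub>A\<^esub>}"] that by simp
  then show ?thesis using B.M.submodule_subset[OF s] by auto
qed

lemma ideal_submodule_base:
  assumes "ideal I A"
  shows "submodule I A (base_gmodule A G)"
proof -
  interpret B: lie_algebroid_module K A G "base_gmodule A G" by (rule base_gmodule_module)
  interpret I: ideal I A by fact
  show ?thesis by (rule B.M.submodule_criterion) (auto simp: I.I_l_closed)
qed

end

context lie_algebroid_module
begin

text \<open>
  \<open>I\<^sup>t M \<subseteq> (I\<^sup>t A) M\<close>, where \<open>I\<^sup>t A\<close> is formed in \<open>A\<close> as a module over itself.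
\<close>

lemma funpow_imul_base:
  assumes I: "ideal I A"
  shows "(M.imul I ^^ t) (carrier M) \<subseteq>
    M.imul ((ideal_mult_submodule A (base_gmodule A G) I ^^ t) (carrier A)) (carrier M)"
proof -
  interpret B: lie_algebroid_module K A G "base_gmodule A G" by (rule base_gmodule_module)
  have Ic: "I \<subseteq> carrier A" using I by (auto simp: ideal.Icarr)
  show ?thesis
  proof (induction t)
    case 0
    have "m \<in> M.imul (carrier A) (carrier M)" if "m \<in> carrier M" for m
      using M.imul_memI[OF M.R.one_closed that] that by simp
    then show ?case by auto
  next
    case (Suc t)
    let ?J = "(B.M.imul I ^^ t) (carrier A)"
    have J: "submodule ?J A (base_gmodule A G)"
      using B.M.funpow_imul_submodule[OF Ic B.M.carrier_is_submodule] by simp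
    have Jc: "?J \<subseteq> carrier A" using B.M.submodule_subset[OF J] by simp
    have IJ: "submodule (B.M.imul I ?J) A (base_gmodule A G)" by (rule B.M.imul_submodule[OF Ic]) (use Jc in simp)
    have IJc: "B.M.imul I ?J \<subseteq> carrier A" using B.M.submodule_subset[OF IJ] by simp
    let ?W = "M.imul (B.M.imul I ?J) (carrier M)"
    have W: "submodule ?W A M" by (rule M.imul_submodule[OF IJc]) simp
    have "M.imul I (M.imul ?J (carrier M)) \<subseteq> ?W"
    proof (rule M.imul_least[OF W])
      fix a y assume a: "a \<in> I" and y: "y \<in> M.imul ?J (carrier M)"
      have "M.imul ?J (carrier M) \<subseteq> {x \<in> carrier M. a \<odot>\<^bsub>M\<^esub> x \<in> ?W}"
      proof (rule M.imul_least)
        show "submodule {x \<in> carrier M. a \<odot>\<^bsub>M\<^esub> x \<in> ?W} A M" using a Ic W by (intro M.submodule_colon) auto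
        fix b m assume b: "b \<in> ?J" and m: "m \<in> carrier M"
        have "a \<odot>\<^bsub>M\<^esub> (b \<odot>\<^bsub>M\<^esub> m) = (a \<otimes>\<^bsub>A\<^esub> b) \<odot>\<^bsub>M\<^esub> m"
          using a b m Ic Jc by (simp add: M.smult_assoc1 subset_iff)
        moreover have "a \<otimes>\<^bsub>A\<^esub> b \<in> B.M.imul I ?J" using B.M.imul_memI[OF a b] by simp
        ultimately have "a \<odot>\<^bsub>M\<^esub> (b \<odot>\<^bsub>M\<^esub> m) \<in> ?W" using M.imul_memI m by metis
        then show "b \<odot>\<^bsub>M\<^esub> m \<in> {x \<in> carrier M. a \<odot>\<^bsub>M\<^esub> x \<in> ?W}" using b m Jc by auto
      qed
      then show "a \<odot>\<^bsub>M\<^esub> y \<in> ?W" using y by auto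
    qed
    moreover have "(M.imul I ^^ Suc t) (carrier M) \<subseteq> M.imul I (M.imul ?J (carrier M))"
      using Suc M.imul_mono[of I I] by simp
    ultimately show ?case by simp
  qed
qed

end

section \<open>Ideals of definition\<close>

theorem proposition2p31:
  fixes K :: "('k, 'c) ring_scheme" and A :: "('k, 'a, 'd) module_scheme"
    and G :: "('a, 'g, 'e) algebroid_scheme" and M :: "('a, 'g, 'm, 'f) gmodule_scheme"
  assumes "field K" and "char_zero K"
    and "algebra K A" and "local_ring A" and "noetherian_ring A"
    and "lie_algebroid K A G"
    and "lie_algebroid_module K A G M" and "finite_type A M"
  shows "(\<forall>J. ideal_of_definition K A G (base_gmodule A G) J \<longrightarrow> ideal_of_definition K A G M J) \<and>
    (\<forall>J. ideal_of_definition K A G M J \<longrightarrow>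
      (\<forall>n>0. glength A G (quotient_gmodule M (ideal_smult A (ideal_power A J (n + 1)) M)) < \<infinity>))"
proof -
  interpret lie_algebroid_module K A G M by fact
  interpret B: lie_algebroid_module K A G "base_gmodule A G" by (rule base_gmodule_module)
  let ?P = "largest_stable_ideal A G"
  obtain m where m: "ideal m A" "m \<noteq> carrier A" and units: "carrier A - m \<subseteq> Units A"
    and proper: "\<And>I. \<lbrakk>ideal I A; I \<noteq> carrier A\<rbrakk> \<Longrightarrow> I \<subseteq> m"
    using noetherian_local_ringE[OF assms(5,4)] by blast
  have P: "ideal ?P A" using largest_stable_stable by (simp add: stable_ideal_def)
  note Pc = stable_ideal_subset[OF largest_stable_stable]
  have Pm: "?P \<subseteq> m"
    unfolding largest_stable_ideal_def
    by (rule M.R.genideal_minimal[OF m(1)]) (use proper in \<open>auto simp: stable_ideal_def\<close>)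
  obtain T where T: "finite T" "T \<subseteq> carrier A" "?P = genideal A T"
    using noetherian_ring.finetely_gen[OF assms(5) P] by blast
  obtain S where S: "finite S" "S \<subseteq> carrier M" "M.span S = carrier M"
    using assms(8) unfolding finite_type_def by blast
  have smul: "ideal_smult A J M = M.imul J (carrier M)" for J
    by (simp add: ideal_smult_def ideal_mult_submodule_def)
  have finite: "glength A G (quotient_gmodule M (M.imul I (carrier M))) < \<infinity>"
    if I: "stable_ideal A G I" and le: "(M.imul ?P ^^ t) (carrier M) \<subseteq> M.imul I (carrier M)" for I t
    using stable_imul[OF I stable_carrier] finite_height_mono[OF finite_height_powers[OF m units T S] le]
    by (rule finite_glength_quotient)
  have stableJ: "stable_ideal A G J" if "ideal J A" "anchor G ` carrier G \<subseteq> derivations_preserving K A J" for J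
    using that by (auto simp: stable_ideal_def derivations_preserving_def)
  show ?thesis
  proof (intro conjI allI impI)
    fix J assume "ideal_of_definition K A G (base_gmodule A G) J"
    then have J: "ideal J A" "J \<noteq> carrier A" "anchor G ` carrier G \<subseteq> derivations_preserving K A J"
      and fin: "glength A G (quotient_gmodule (base_gmodule A G) (B.M.imul J (carrier A))) < \<infinity>"
      by (auto simp: ideal_of_definition_def ideal_smult_def ideal_mult_submodule_def)
    note sJ = stableJ[OF J(1,3)]
    have st: "B.stable (B.M.imul J (carrier A))" using B.stable_imul[OF sJ B.stable_carrier] by simp
    obtain t where "(B.M.imul ?P ^^ t) (carrier A) \<subseteq> B.M.imul J (carrier A)"
      using B.power_subset_of_finite_glength[OF m units Pm T, of "{\<one>\<^bsub>A\<^esub>}"] st fin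
      by (auto simp: base_gmodule_span)
    also have "\<dots> \<subseteq> J"
      using J(1) by (intro B.M.imul_least[OF ideal_submodule_base]) (auto simp: ideal.I_r_closed)
    finally have "M.imul ((B.M.imul ?P ^^ t) (carrier A)) (carrier M) \<subseteq> M.imul J (carrier M)"
      by (intro M.imul_mono) auto
    then have "(M.imul ?P ^^ t) (carrier M) \<subseteq> M.imul J (carrier M)"
      using funpow_imul_base[OF P] by blast
    then have "glength A G (quotient_gmodule M (ideal_smult A J M)) < \<infinity>"
      unfolding smul by (rule finite[OF sJ])
    with J show "ideal_of_definition K A G M J" by (simp add: ideal_of_definition_def)
  next
    fix J n assume "ideal_of_definition K A G M J"
    then have J: "ideal J A" "anchor G ` carrier G \<subseteq> derivations_preserving K A J"
      and fin: "glength A G (quotient_gmodule M (M.imul J (carrier M))) < \<infinity>"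
      by (auto simp: ideal_of_definition_def smul)
    note sJ = stableJ[OF J]
    obtain t where "(M.imul ?P ^^ t) (carrier M) \<subseteq> M.imul J (carrier M)"
      using power_subset_of_finite_glength[OF m units Pm T S stable_imul[OF sJ stable_carrier] fin] by blast
    then have "(M.imul ?P ^^ (t * (n + 1))) (carrier M) \<subseteq> (M.imul J ^^ (n + 1)) (carrier M)"
      by (rule M.funpow_imul_le[OF Pc stable_ideal_subset[OF sJ] M.carrier_is_submodule])
    also have "\<dots> \<subseteq> M.imul (ideal_power A J (n + 1)) (carrier M)"
      by (rule M.funpow_imul_ideal_power[OF J(1)])
    finally show "glength A G (quotient_gmodule M (ideal_smult A (ideal_power A J (n + 1)) M)) < \<infinity>"
      unfolding smul by (rule finite[OF stable_ideal_power[OF sJ]])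
  qed
qed

end
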